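(* Let $\sum_{n=0}^\infty \beta_4(n) q^n = 1/\mathrm{E}_4(q)$. Then $(-1)^n \beta_4(n) \in 240\,\mathbb{N}$ for all $n \in \mathbb{N}$. Further, \[ \beta_4(n) \sim -\frac{1}{\Theta(\mathrm{E}_4)(q_\rho)}\, q_\rho^{-n} \qquad (n\to\infty), \] where $\Theta(\mathrm{E}_4)(q_\rho) = -\mathrm{E}_6(q_\rho)/3$.
   Context: $\mathrm{E}_4(q) = 1 + 240\sum_{n\ge1}\sigma_3(n)q^n$ and $\mathrm{E}_6(q) = 1 - 504\sum_{n\ge1}\sigma_5(n)q^n$, with $\sigma_\ell(n) = \sum_{d\mid n} d^\ell$; these are the Eisenstein series of weight $4$ and $6$ as power series in $q = e^{2\pi i z}$. The coefficients $\beta_4(n)$ are those of the expansion of $1/\mathrm{E}_4(q)$ around $q = 0$. $\rho = \frac12 + \frac{\sqrt3}{2}i$ and $q_\rho = e^{2\pi i\rho} = -e^{-\pi\sqrt3}$. $\Theta = q\frac{\mathrm d}{\mathrm dq}$ acts on power series by $\Theta(\sum a(n)q^n) = \sum n a(n) q^n$, and $\Theta(\mathrm{E}_4)(q_\rho)$ is its value at $q=q_\rho$. $\mathbb{N}$ denotes the positive integers. *)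

theory Defs
  imports "HOL-Analysis.Analysis" "HOL-Library.Landau_Symbols"
begin

definition divisor_sum :: "nat \<Rightarrow> nat \<Rightarrow> nat" where
  "divisor_sum l n = (\<Sum>d | d dvd n. d ^ l)"

definition E4 :: "complex fps" where
  "E4 = Abs_fps (\<lambda>n. if n = 0 then 1 else 240 * of_nat (divisor_sum 3 n))"

definition E6 :: "complex fps" where
  "E6 = Abs_fps (\<lambda>n. if n = 0 then 1 else - 504 * of_nat (divisor_sum 5 n))"

definition beta4 :: "nat \<Rightarrow> complex" where
  "beta4 n = fps_nth (1 / E4) n"

definition Theta :: "complex fps \<Rightarrow> complex fps" where
  "Theta f = Abs_fps (\<lambda>n. of_nat n * fps_nth f n)"

definition rho :: complex where
  "rho = 1 / 2 + of_real (sqrt 3) / 2 * \<i>"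

definition q_rho :: complex where
  "q_rho = exp (2 * of_real pi * \<i> * rho)"

end

theory Submission
  imports Defs
begin

text \<open>The recursion for the coefficients of \<open>1 / E4\<close> gives by induction
  \<open>b n \<ge> 200 * b (n - 1)\<close> for \<open>b n = (- 1) ^ n * beta4 n\<close>, because the terms after the first
  are negligible in comparison with it; this yields the sign.

  For the asymptotics, the sum of \<open>(m * rho + n) ^ (- 4)\<close> over the nonzero lattice points is
  multiplied by \<open>rho ^ (- 4) \<noteq> 1\<close> under the rotation by \<open>rho\<close>, which permutes the lattice, and
  hence vanishes; summing its rows by
  the Lipschitz formula turns this into \<open>E4 (q_rho) = 0\<close>. The zero can be divided out, and the
  inverse of the remaining factor converges on a larger disc.

  The value of \<open>Theta E4\<close> at \<open>q_rho\<close> comes from Ramanujan's identity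
  \<open>3 * Theta E4 = E2 * E4 - E6\<close>, which is a convolution formula for divisor sums and follows from
  an elementary identity of Liouville.\<close>

section \<open>Liouville's identity and the derivative of \<open>E4\<close>\<close>

text \<open>A quadruple records a splitting n = k + (n - k) together with a divisor a of k = a x and
  a divisor b of n - k = b y. Sums over it are therefore convolutions of divisor sums.\<close>

definition quad_reps :: "nat \<Rightarrow> (nat \<times> nat \<times> nat \<times> nat) set" where
  "quad_reps n = {(a, b, x, y). 0 < a \<and> 0 < b \<and> 0 < x \<and> 0 < y \<and> a * x + b * y = n}"

lemma finite_quad_reps [simp]: "finite (quad_reps n)"
proof (rule finite_subset)
  show "quad_reps n \<subseteq> {..n} \<times> {..n} \<times> {..n} \<times> {..n}"
  proof (clarsimp simp: quad_reps_def)
    fix a b x y :: nat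
    assume p: "0 < a" "0 < b" "0 < x" "0 < y"
    have "a * 1 \<le> a * x" "1 * x \<le> a * x" "b * 1 \<le> b * y" "1 * y \<le> b * y"
      using p by (intro mult_le_mono; simp)+
    then show "a \<le> a * x + b * y \<and> b \<le> a * x + b * y \<and> x \<le> a * x + b * y \<and> y \<le> a * x + b * y"
      by linarith
  qed
qed simp

lemma sum_quad_reps_trichotomy:
  fixes F :: "nat \<times> nat \<times> nat \<times> nat \<Rightarrow> 'c::comm_monoid_add" and u v :: "nat \<times> nat \<times> nat \<times> nat \<Rightarrow> nat"
  shows "sum F (quad_reps n) = sum F {p \<in> quad_reps n. u p < v p} + sum F {p \<in> quad_reps n. v p < u p}
           + sum F {p \<in> quad_reps n. u p = v p}"
proof -
  have eq: "quad_reps n = ({p \<in> quad_reps n. u p < v p} \<union> {p \<in> quad_reps n. v p < u p}) \<union> {p \<in> quad_reps n. u p = v p}"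
    by auto
  show ?thesis
    by (subst eq, subst sum.union_disjoint, force, force, force,
        subst sum.union_disjoint, auto)
qed

text \<open>The substitution \<open>(a, b, x, y) \<mapsto> (a, a + b, x - y, y)\<close> turns \<open>x > y\<close> into \<open>a < b\<close>, and
  \<open>(a, b, x, y) \<mapsto> (a - b, b, x, x + y)\<close> turns \<open>a > b\<close> into \<open>x < y\<close>; after cancellation only
  the diagonals \<open>a = b\<close> and \<open>x = y\<close> survive.\<close>
lemma liouville_identity:
  fixes f :: "int \<Rightarrow> 'c::comm_ring_1"
  assumes even: "\<And>t. f (- t) = f t"
  shows "(\<Sum>(a,b,x,y)\<in>quad_reps n. f (int a - int b) - f (int a + int b)) =
    (\<Sum>(a,b,x,y)\<in>{(a,b,x,y)\<in>quad_reps n. a = b}. f 0 + 2 * f (int b)) -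
    (\<Sum>(a,b,x,y)\<in>{(a,b,x,y)\<in>quad_reps n. x = y}. 2 * f (int b) + f (int a + int b))"
proof -
  let ?Q = "quad_reps n"
  define al where "al = {(a,b,x,y)\<in>?Q. a < b}"
  define ag where "ag = {(a,b,x,y)\<in>?Q. b < a}"
  define ae where "ae = {(a,b,x,y)\<in>?Q. a = b}"
  define xl where "xl = {(a,b,x,y)\<in>?Q. x < y}"
  define xg where "xg = {(a,b,x,y)\<in>?Q. y < x}"
  define xe where "xe = {(a,b,x,y)\<in>?Q. x = y}"
  have splita: "sum F ?Q = sum F al + sum F ag + sum F ae" for F :: "nat \<times> nat \<times> nat \<times> nat \<Rightarrow> 'c"
    using sum_quad_reps_trichotomy[of F n "\<lambda>(a,b,x,y). a" "\<lambda>(a,b,x,y). b"]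
    by (simp add: al_def ag_def ae_def case_prod_unfold)
  have splitx: "sum F ?Q = sum F xl + sum F xg + sum F xe" for F :: "nat \<times> nat \<times> nat \<times> nat \<Rightarrow> 'c"
    using sum_quad_reps_trichotomy[of F n "\<lambda>(a,b,x,y). x" "\<lambda>(a,b,x,y). y"]
    by (simp add: xl_def xg_def xe_def case_prod_unfold)
  \<comment> \<open>Exchanging (a, x) with (b, y) swaps the two halves; evenness of \<open>f\<close>
    absorbs the sign change of a - b.\<close>
  have swap_a: "(\<Sum>(a,b,x,y)\<in>ag. f (int a - int b)) = (\<Sum>(a,b,x,y)\<in>al. f (int a - int b))"
    by (rule sum.reindex_bij_witness[where i = "\<lambda>(a,b,x,y). (b,a,y,x)" and j = "\<lambda>(a,b,x,y). (b,a,y,x)"])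
       (use even[of "int b - int a" for a b] in \<open>auto simp: al_def ag_def quad_reps_def algebra_simps\<close>)
  have swap_x: "(\<Sum>(a,b,x,y)\<in>xl. f (int a + int b)) = (\<Sum>(a,b,x,y)\<in>xg. f (int a + int b))"
    by (rule sum.reindex_bij_witness[where i = "\<lambda>(a,b,x,y). (b,a,y,x)" and j = "\<lambda>(a,b,x,y). (b,a,y,x)"])
       (auto simp: xl_def xg_def quad_reps_def algebra_simps)
  have shift1: "(\<Sum>(a,b,x,y)\<in>xg. f (int b)) = (\<Sum>(a,b,x,y)\<in>al. f (int a - int b))"
    by (rule sum.reindex_bij_witness[where j = "\<lambda>(a,b,x,y). (a,a+b,x-y,y)" and i = "\<lambda>(a,b,x,y). (a,b-a,x+y,y)"])
       (auto simp: al_def xg_def quad_reps_def algebra_simps diff_mult_distrib2 diff_mult_distrib even trans_le_add1)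
  have shift2: "(\<Sum>(a,b,x,y)\<in>xg. f (int a + int b)) = (\<Sum>(a,b,x,y)\<in>al. f (int b))"
    by (rule sum.reindex_bij_witness[where j = "\<lambda>(a,b,x,y). (a,a+b,x-y,y)" and i = "\<lambda>(a,b,x,y). (a,b-a,x+y,y)"])
       (auto simp: al_def xg_def quad_reps_def algebra_simps diff_mult_distrib2 diff_mult_distrib trans_le_add1)
  have shift3: "(\<Sum>(a,b,x,y)\<in>ag. f (int b)) = (\<Sum>(a,b,x,y)\<in>xl. f (int b))"
    by (rule sum.reindex_bij_witness[where j = "\<lambda>(a,b,x,y). (a-b,b,x,x+y)" and i = "\<lambda>(a,b,x,y). (a+b,b,x,y-x)"])
       (auto simp: ag_def xl_def quad_reps_def algebra_simps diff_mult_distrib2 diff_mult_distrib trans_le_add1)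
  have ae0: "(\<Sum>(a,b,x,y)\<in>ae. f (int a - int b)) = (\<Sum>(a,b,x,y)\<in>ae. f 0)"
    by (rule sum.cong) (auto simp: ae_def)
  have "(\<Sum>(a,b,x,y)\<in>?Q. f (int a - int b) - f (int a + int b)) =
        (\<Sum>(a,b,x,y)\<in>?Q. f (int a - int b)) - (\<Sum>(a,b,x,y)\<in>?Q. f (int a + int b))"
    by (simp add: sum_subtractf case_prod_unfold)
  also have "(\<Sum>(a,b,x,y)\<in>?Q. f (int a - int b)) = 2 * (\<Sum>(a,b,x,y)\<in>xg. f (int b)) + (\<Sum>(a,b,x,y)\<in>ae. f 0)"
    by (simp only: splita swap_a shift1 ae0) simp
  also have "(\<Sum>(a,b,x,y)\<in>?Q. f (int a + int b)) = 2 * (\<Sum>(a,b,x,y)\<in>al. f (int b)) + (\<Sum>(a,b,x,y)\<in>xe. f (int a + int b))"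
    by (simp only: splitx swap_x shift2) simp
  \<comment> \<open>Both trichotomies count f(b) over the whole set. The parts a > b and x < y
    cancel by \<open>shift3\<close>, which ties the part a < b to the part x > y.\<close>
  also have "(\<Sum>(a,b,x,y)\<in>al. f (int b)) = (\<Sum>(a,b,x,y)\<in>xg. f (int b)) + (\<Sum>(a,b,x,y)\<in>xe. f (int b)) - (\<Sum>(a,b,x,y)\<in>ae. f (int b))"
    using splita[of "\<lambda>(a,b,x,y). f (int b)"] splitx[of "\<lambda>(a,b,x,y). f (int b)"] shift3 by (simp add: algebra_simps)
  finally show ?thesis
    unfolding ae_def [symmetric] xe_def [symmetric]
    by (simp add: case_prod_unfold sum.distrib sum_distrib_left algebra_simps)
qed

text \<open>For a = b = d the equation reads d (x + y) = n, so d divides n and x takes the values 1,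
  ..., n / d - 1.\<close>

lemma sum_quad_reps_first_diagonal:
  fixes g :: "nat \<Rightarrow> 'c::comm_ring_1"
  assumes "n > 0"
  shows "(\<Sum>(a,b,x,y)\<in>{(a,b,x,y)\<in>quad_reps n. a = b}. g b) = (\<Sum>d | d dvd n. of_nat (n div d - 1) * g d)"
proof -
  have "(\<Sum>(a,b,x,y)\<in>{(a,b,x,y)\<in>quad_reps n. a = b}. g b) =
        (\<Sum>(d,x)\<in>(SIGMA d:{d. d dvd n}. {1..<n div d}). g d)"
  proof (rule sum.reindex_bij_witness[where j = "\<lambda>(a,b,x,y). (a,x)" and i = "\<lambda>(d,x). (d,d,x,n div d - x)"], goal_cases)
    case (1 p)
    then show ?case by (auto simp: quad_reps_def distrib_left [symmetric])
  next
    case (2 p)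
    then show ?case by (auto simp: quad_reps_def distrib_left [symmetric])
  next
    case (3 p)
    then show ?case by auto
  next
    case (4 p)
    then show ?case using assms
      by (auto simp: quad_reps_def distrib_left [symmetric] intro: dvd_pos_nat)
  qed (auto simp: quad_reps_def)
  also have "\<dots> = (\<Sum>d | d dvd n. of_nat (n div d - 1) * g d)"
    using assms by (subst sum.Sigma [symmetric]) auto
  finally show ?thesis .
qed

text \<open>For x = y the equation reads (a + b) x = n, so d = a + b is a divisor of n and b runs
  through 1, ..., d - 1.\<close>

lemma sum_quad_reps_second_diagonal:
  fixes g :: "nat \<Rightarrow> nat \<Rightarrow> 'c::comm_ring_1"
  assumes "n > 0"
  shows "(\<Sum>(a,b,x,y)\<in>{(a,b,x,y)\<in>quad_reps n. x = y}. g a b) = (\<Sum>d | d dvd n. \<Sum>b=1..<d. g (d - b) b)"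
proof -
  have "(\<Sum>(a,b,x,y)\<in>{(a,b,x,y)\<in>quad_reps n. x = y}. g a b) =
        (\<Sum>(d,b)\<in>(SIGMA d:{d. d dvd n}. {1..<d}). g (d - b) b)"
  proof (rule sum.reindex_bij_witness[where j = "\<lambda>(a,b,x,y). (a+b,b)" and i = "\<lambda>(d,b). (d-b,b,n div d,n div d)"], goal_cases)
    case (1 p)
    then show ?case by (auto simp: quad_reps_def distrib_right [symmetric])
  next
    case (2 p)
    then show ?case by (auto simp: quad_reps_def distrib_right [symmetric])
  next
    case (3 p)
    then show ?case by auto
  next
    case (4 p)
    then show ?case using assms
      by (auto simp: quad_reps_def distrib_right [symmetric] div_greater_zero_iff dvd_imp_le)
  qed (auto simp: quad_reps_def)
  also have "\<dots> = (\<Sum>d | d dvd n. \<Sum>b=1..<d. g (d - b) b)"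
    using assms by (subst sum.Sigma [symmetric]) auto
  finally show ?thesis .
qed

lemma sum_quad_reps_product:
  fixes g h :: "nat \<Rightarrow> 'c::comm_ring_1"
  shows "(\<Sum>(a,b,x,y)\<in>quad_reps n. g a * h b) =
     (\<Sum>k=1..<n. (\<Sum>d | d dvd k. g d) * (\<Sum>d | d dvd n - k. h d))"
proof -
  have "(\<Sum>(a,b,x,y)\<in>quad_reps n. g a * h b) =
        (\<Sum>(k,a,b)\<in>(SIGMA k:{1..<n}. {d. d dvd k} \<times> {d. d dvd n - k}). g a * h b)"
  proof (rule sum.reindex_bij_witness[where j = "\<lambda>(a,b,x,y). (a*x,a,b)" and i = "\<lambda>(k,a,b). (a,b,k div a,(n-k) div b)"], goal_cases)
    case (4 p)
    then show ?case
      using dvd_pos_nat[of "n - fst p" "snd (snd p)"] dvd_pos_nat[of "fst p" "fst (snd p)"]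
      by (auto simp: quad_reps_def div_greater_zero_iff intro!: dvd_imp_le)
  qed (auto simp: quad_reps_def)
  also have "\<dots> = (\<Sum>k=1..<n. \<Sum>(a,b)\<in>{d. d dvd k} \<times> {d. d dvd n - k}. g a * h b)"
    by (subst sum.Sigma [symmetric]) auto
  also have "\<dots> = (\<Sum>k=1..<n. (\<Sum>d | d dvd k. g d) * (\<Sum>d | d dvd n - k. h d))"
    by (simp add: sum_product sum.cartesian_product)
  finally show ?thesis .
qed

text \<open>Faulhaber's formula, with the denominator 30 cleared so that it stays in the
  integers.\<close>

lemma sum_fourth_powers: "30 * (\<Sum>b=1..<d. int b ^ 4) = 6 * int d ^ 5 - 15 * int d ^ 4 + 10 * int d ^ 3 - int d"
proof (induction d)
  case (Suc d)
  have "(\<Sum>b=1..<Suc d. int b ^ 4) = (\<Sum>b=1..<d. int b ^ 4) + int d ^ 4"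
    by (cases "d = 0") (auto simp: sum.atLeastLessThan_Suc)
  then show ?case using Suc by (simp add: algebra_simps eval_nat_numeral)
qed simp

text \<open>Liouville's identity for f(t) = t^4: since (a - b)^4 - (a + b)^4 = -8 (a^3 b + a b^3),
  its left side is -16 times the convolution, while both diagonals are explicit divisor
  sums.\<close>

lemma divisor_sum_1_3_convolution:
  assumes "n > 0"
  shows "240 * (\<Sum>k=1..<n. int (divisor_sum 3 k) * int (divisor_sum 1 (n - k))) =
    21 * int (divisor_sum 5 n) - 30 * int n * int (divisor_sum 3 n) + 10 * int (divisor_sum 3 n) - int (divisor_sum 1 n)"
proof -
  let ?S = "\<Sum>k=1..<n. int (divisor_sum 3 k) * int (divisor_sum 1 (n - k))"
  have S1: "(\<Sum>(a,b,x,y)\<in>quad_reps n. int a ^ 3 * int b) = ?S"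
    using sum_quad_reps_product[of "\<lambda>a. int a ^ 3" int n] by (simp add: divisor_sum_def)
  have S2: "(\<Sum>(a,b,x,y)\<in>quad_reps n. int b ^ 3 * int a) = (\<Sum>(a,b,x,y)\<in>quad_reps n. int a ^ 3 * int b)"
    by (rule sum.reindex_bij_witness[where i = "\<lambda>(a,b,x,y). (b,a,y,x)" and j = "\<lambda>(a,b,x,y). (b,a,y,x)"])
       (auto simp: quad_reps_def)
  have "- 16 * ?S = (\<Sum>(a,b,x,y)\<in>quad_reps n. (int a - int b) ^ 4 - (int a + int b) ^ 4)"
  proof -
    have "(\<Sum>(a,b,x,y)\<in>quad_reps n. (int a - int b) ^ 4 - (int a + int b) ^ 4) =
          (\<Sum>(a,b,x,y)\<in>quad_reps n. - 8 * (int a ^ 3 * int b) + - 8 * (int b ^ 3 * int a))"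
      by (rule sum.cong) (auto simp: algebra_simps eval_nat_numeral)
    also have "\<dots> = - 8 * (\<Sum>(a,b,x,y)\<in>quad_reps n. int a ^ 3 * int b) + - 8 * (\<Sum>(a,b,x,y)\<in>quad_reps n. int b ^ 3 * int a)"
      by (simp only: case_prod_unfold sum.distrib sum_distrib_left)
    finally show ?thesis using S1 S2 by simp
  qed
  also have "\<dots> = (\<Sum>(a,b,x,y)\<in>{(a,b,x,y)\<in>quad_reps n. a = b}. 2 * int b ^ 4) -
    (\<Sum>(a,b,x,y)\<in>{(a,b,x,y)\<in>quad_reps n. x = y}. 2 * int b ^ 4 + (int a + int b) ^ 4)"
    using liouville_identity[of "\<lambda>t. t ^ 4" n] by simp
  also have "(\<Sum>(a,b,x,y)\<in>{(a,b,x,y)\<in>quad_reps n. a = b}. 2 * int b ^ 4) =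
      (\<Sum>d | d dvd n. int (n div d - 1) * (2 * int d ^ 4))"
    by (rule sum_quad_reps_first_diagonal[OF assms])
  also have "(\<Sum>(a,b,x,y)\<in>{(a,b,x,y)\<in>quad_reps n. x = y}. 2 * int b ^ 4 + (int a + int b) ^ 4) =
      (\<Sum>d | d dvd n. \<Sum>b=1..<d. 2 * int b ^ 4 + (int (d - b) + int b) ^ 4)"
    by (rule sum_quad_reps_second_diagonal[OF assms])
  \<comment> \<open>The factor 15 turns the coefficient 2 of the fourth powers into the 30 of
    \<open>sum_fourth_powers\<close>.\<close>
  finally have "- 240 * ?S = (\<Sum>d | d dvd n. 15 * (int (n div d - 1) * (2 * int d ^ 4)) -
       15 * (\<Sum>b=1..<d. 2 * int b ^ 4 + (int (d - b) + int b) ^ 4))"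
    unfolding sum_subtractf sum_distrib_left [symmetric] by linarith
  also have "\<dots> = (\<Sum>d | d dvd n. 30 * int n * int d ^ 3 - 21 * int d ^ 5 - 10 * int d ^ 3 + int d)"
  proof (rule sum.cong[OF refl], clarify)
    fix d assume "d dvd n"
    then obtain e where e: "n = d * e" by auto
    have pos: "d > 0" "e > 0" using assms e by auto
    have "(\<Sum>b=1..<d. 2 * int b ^ 4 + (int (d - b) + int b) ^ 4) = (\<Sum>b=1..<d. 2 * int b ^ 4 + int d ^ 4)"
      by (rule sum.cong) (auto simp: of_nat_diff)
    also have "15 * \<dots> = 30 * (\<Sum>b=1..<d. int b ^ 4) + 15 * (int d - 1) * int d ^ 4"
      using pos by (simp add: sum.distrib sum_distrib_left [symmetric] of_nat_diff)
    finally show "15 * (int (n div d - 1) * (2 * int d ^ 4)) - 15 * (\<Sum>b=1..<d. 2 * int b ^ 4 + (int (d - b) + int b) ^ 4) =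
        30 * int n * int d ^ 3 - 21 * int d ^ 5 - 10 * int d ^ 3 + int d"
      using pos unfolding sum_fourth_powers
      by (simp add: e of_nat_diff algebra_simps eval_nat_numeral)
  qed
  also have "\<dots> = 30 * int n * int (divisor_sum 3 n) - 21 * int (divisor_sum 5 n) - 10 * int (divisor_sum 3 n) + int (divisor_sum 1 n)"
    by (simp add: divisor_sum_def sum.distrib sum_subtractf sum_distrib_left)
  finally show ?thesis by linarith
qed

text \<open>The quasimodular Eisenstein series of weight 2. At \<open>q_rho\<close> it enters only
  through the product with \<open>E4\<close>, which vanishes there.\<close>

definition E2 :: "complex fps" where
  "E2 = Abs_fps (\<lambda>n. if n = 0 then 1 else - 24 * of_nat (divisor_sum 1 n))"

text \<open>In the n-th coefficient of \<open>E2 * E4\<close> the boundary terms of the Cauchy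
  product cancel the pure sigma_3 and sigma_1 terms of the convolution formula; 720 n sigma_3(n) -
  504 sigma_5(n) remains.\<close>

theorem ramanujan_Theta_E4: "3 * Theta E4 = E2 * E4 - E6"
proof (rule fps_ext)
  fix n
  show "fps_nth (3 * Theta E4) n = fps_nth (E2 * E4 - E6) n"
  proof (cases "n = 0")
    case True
    then show ?thesis by (simp add: Theta_def E2_def E4_def E6_def fps_mult_nth_0 numeral_fps_const)
  next
    case False
    let ?s = "\<lambda>l k. of_nat (divisor_sum l k) :: complex"
    have "{0..n} = insert 0 (insert n {1..<n})" using False by auto
    then have "fps_nth (E2 * E4) n = 240 * ?s 3 n - 24 * ?s 1 n
         + (\<Sum>k=1..<n. fps_nth E4 k * fps_nth E2 (n - k))"
      using False by (subst mult.commute) (simp add: fps_mult_nth E2_def E4_def)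
    also have "(\<Sum>k=1..<n. fps_nth E4 k * fps_nth E2 (n - k)) = - 24 * (240 * (\<Sum>k=1..<n. ?s 3 k * ?s 1 (n - k)))"
      unfolding sum_distrib_left by (rule sum.cong) (auto simp: E2_def E4_def)
    also have "240 * (\<Sum>k=1..<n. ?s 3 k * ?s 1 (n - k)) =
        21 * ?s 5 n - 30 * of_nat n * ?s 3 n + 10 * ?s 3 n - ?s 1 n"
      using arg_cong[OF divisor_sum_1_3_convolution[of n], of of_int] False by simp
    finally show ?thesis
      using False by (simp add: Theta_def E4_def E6_def numeral_fps_const algebra_simps)
  qed
qed

section \<open>Sign and divisibility of the coefficients\<close>

text \<open>The sum of all cubes up to n is (n (n + 1) / 2)^2. It equals 9 at n = 2 and grows by a
  factor ((n + 2) / n)^2, at most 4, in each step from there on.\<close>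

lemma divisor_sum_3_le:
  assumes "n \<ge> 2"
  shows "divisor_sum 3 n \<le> 9 * 4 ^ (n - 2)"
proof -
  have cubes: "4 * (\<Sum>d=1..m. d ^ 3) = (m * (m + 1)) ^ 2" for m :: nat
    by (induction m) (auto simp: algebra_simps eval_nat_numeral)
  have "divisor_sum 3 n \<le> (\<Sum>d=1..n. d ^ 3)"
    unfolding divisor_sum_def
    using assms dvd_pos_nat[of n] dvd_imp_le[of _ n] by (intro sum_mono2) (auto simp: Suc_le_eq)
  moreover have "(n * (n + 1)) ^ 2 \<le> 4 * (9 * 4 ^ (n - 2))"
    using assms
  proof (induction n rule: dec_induct)
    case (step n)
    have "(Suc n * (Suc n + 1)) ^ 2 \<le> (2 * (n * (n + 1))) ^ 2"
    proof (rule power_mono)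
      show "Suc n * (Suc n + 1) \<le> 2 * (n * (n + 1))"
      proof -
        have "2 * n \<le> n * n" using step.hyps by (intro mult_le_mono1) simp
        then have "n + 2 \<le> n * n" using step.hyps by linarith
        then show ?thesis by (simp add: algebra_simps)
      qed
    qed simp
    also have "\<dots> \<le> 4 * (4 * (9 * 4 ^ (n - 2)))"
      using step.IH unfolding power_mult_distrib by simp
    also have "\<dots> = 4 * (9 * 4 ^ (Suc n - 2))"
    proof -
      have "Suc n - 2 = Suc (n - 2)" using step.hyps by linarith
      then show ?thesis by simp
    qed
    finally show ?case .
  qed simp
  ultimately show ?thesis
    using cubes[of n] by linarith
qed

lemma divisor_sum_1_right [simp]: "divisor_sum l (Suc 0) = 1"
  by (simp add: divisor_sum_def)

lemma E4_nth_0 [simp]: "fps_nth E4 0 = 1"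
  by (simp add: E4_def)

lemma beta4_0: "beta4 0 = 1"
  by (simp add: beta4_def)

lemma beta4_rec:
  assumes "n > 0"
  shows "beta4 n = - 240 * (\<Sum>k=1..n. of_nat (divisor_sum 3 k) * beta4 (n - k))"
proof -
  have E4_mult: "E4 * (1 / E4) = 1"
    by (simp add: fps_divide_unit inverse_mult_eq_1')
  have "0 = fps_nth (E4 * (1 / E4)) n"
    unfolding E4_mult using assms by simp
  also have "\<dots> = (\<Sum>k=0..n. fps_nth E4 k * beta4 (n - k))"
    by (simp only: fps_mult_nth beta4_def)
  also have "\<dots> = beta4 n + (\<Sum>k=1..n. fps_nth E4 k * beta4 (n - k))"
    by (simp add: sum.atLeast_Suc_atMost)
  also have "(\<Sum>k=1..n. fps_nth E4 k * beta4 (n - k)) = 240 * (\<Sum>k=1..n. of_nat (divisor_sum 3 k) * beta4 (n - k))"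
    unfolding sum_distrib_left by (rule sum.cong) (auto simp: E4_def)
  finally show ?thesis by (simp add: eq_neg_iff_add_eq_0)
qed

lemma beta4_int: "\<exists>c::int. beta4 n = of_int c"
proof (induction n rule: less_induct)
  case (less n)
  show ?case
  proof (cases "n = 0")
    case True
    then show ?thesis by (intro exI[of _ 1]) (simp add: beta4_0)
  next
    case False
    have "\<forall>m. \<exists>c::int. m < n \<longrightarrow> beta4 m = of_int c" using less by blast
    then obtain c :: "nat \<Rightarrow> int" where c: "\<And>m. m < n \<Longrightarrow> beta4 m = of_int (c m)"
      by metis
    have "beta4 n = of_int (- 240 * (\<Sum>k=1..n. int (divisor_sum 3 k) * c (n - k)))"
      using False by (subst beta4_rec) (auto simp: c)
    then show ?thesis by blast
  qed
qed

text \<open>The growth bound reproduces itself: it makes earlier values decay by 1/200 per step,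
  faster than sigma_3 grows by \<open>divisor_sum_3_le\<close>, so the term k = 1, of size 240 b(n -
  1), dominates all others whatever their signs.\<close>

lemma signed_recurrence_growth:
  fixes b :: "nat \<Rightarrow> real"
  assumes b0: "b 0 = 1"
    and rec: "\<And>n. n > 0 \<Longrightarrow> b n = 240 * (\<Sum>k=1..n. (- 1) ^ (k + 1) * real (divisor_sum 3 k) * b (n - k))"
  shows "b n > 0 \<and> (n > 0 \<longrightarrow> 200 * b (n - 1) \<le> b n)"
proof (induction n rule: less_induct)
  case (less n)
  show ?case
  proof (cases "n = 0")
    case True
    then show ?thesis by (simp add: b0)
  next
    case False
    have decay: "b (n - Suc k) \<le> b (n - 1) / 200 ^ k" if "k < n" for k
      using that
    proof (induction k)
      case (Suc k)
      have "200 * b (n - Suc k - 1) \<le> b (n - Suc k)"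
        by (rule less.IH[THEN conjunct2, rule_format]) (use Suc.prems in linarith)+
      also have "\<dots> \<le> b (n - 1) / 200 ^ k" using Suc by simp
      finally show ?case by (simp add: field_simps)
    qed simp
    have pos: "b (n - 1) > 0" by (rule less.IH[THEN conjunct1]) (use False in linarith)
    have nonneg: "b (n - k) \<ge> 0" if "k > 0" for k
      by (rule less_imp_le, rule less.IH[THEN conjunct1]) (use False that in linarith)
    \<comment> \<open>Growth 4 against decay 200 leaves the ratio 1/50, with first term 9/200 at k =
      2.\<close>
    have term_ge: "(- 1) ^ (k + 1) * real (divisor_sum 3 k) * b (n - k) \<ge> - (9 / 200 * b (n - 1)) * (1 / 50) ^ (k - 2)"
      if k: "k \<in> {2..n}" for k
    proof -
      have "real (divisor_sum 3 k) * b (n - k) \<le> (9 * 4 ^ (k - 2)) * (b (n - 1) / 200 ^ (k - 1))"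
      proof (rule mult_mono)
        show "real (divisor_sum 3 k) \<le> 9 * 4 ^ (k - 2)"
          using of_nat_mono[OF divisor_sum_3_le[of k], where 'a = real] k by simp
        show "b (n - k) \<le> b (n - 1) / 200 ^ (k - 1)"
        proof -
          have "k - 1 < n" "Suc (k - 1) = k" using k by auto
          then show ?thesis using decay[of "k - 1"] by simp
        qed
        show "0 \<le> b (n - k)" using nonneg k by simp
      qed simp
      also have "\<dots> = 9 / 200 * b (n - 1) * (1 / 50) ^ (k - 2)"
      proof -
        from k obtain j where j: "k = j + 2" by (metis atLeastAtMost_iff le_add_diff_inverse2)
        have "(200::real) ^ j = 4 ^ j * 50 ^ j" by (simp flip: power_mult_distrib)
        then show ?thesis by (simp add: j field_simps power_divide)
      qed
      finally have *: "real (divisor_sum 3 k) * b (n - k) \<le> 9 / 200 * b (n - 1) * (1 / 50) ^ (k - 2)" .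
      have "0 \<le> b (n - k)" using nonneg k by simp
      then have "0 \<le> real (divisor_sum 3 k) * b (n - k)" by simp
      with * show ?thesis by (cases "even k") (auto simp: mult.assoc)
    qed
    have "(\<Sum>k=2..n. (1 / 50 :: real) ^ (k - 2)) \<le> 50 / 49"
    proof -
      have "(\<Sum>k=2..n. (1 / 50 :: real) ^ (k - 2)) = (\<Sum>j<n - 1. (1 / 50) ^ j)"
        by (rule sum.reindex_bij_witness[where i = "\<lambda>j. j + 2" and j = "\<lambda>k. k - 2"]) auto
      also have "\<dots> \<le> 50 / 49" by (subst sum_gp_strict) (auto simp: field_simps)
      finally show ?thesis .
    qed
    then have "- (9 / 200 * b (n - 1)) * (50 / 49) \<le> - (9 / 200 * b (n - 1)) * (\<Sum>k=2..n. (1 / 50) ^ (k - 2))"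
      using pos by (intro mult_left_mono_neg) auto
    also have "\<dots> \<le> (\<Sum>k=2..n. (- 1) ^ (k + 1) * real (divisor_sum 3 k) * b (n - k))"
      unfolding sum_distrib_left by (rule sum_mono) (rule term_ge)
    finally have tail: "- (9 / 200 * b (n - 1)) * (50 / 49) \<le> (\<Sum>k=2..n. (- 1) ^ (k + 1) * real (divisor_sum 3 k) * b (n - k))" .
    have "b n = 240 * (b (n - 1) + (\<Sum>k=2..n. (- 1) ^ (k + 1) * real (divisor_sum 3 k) * b (n - k)))"
      using False by (subst rec) (auto simp: sum.atLeast_Suc_atMost numeral_2_eq_2)
    \<comment> \<open>Here 240 (1 - 9/200 * 50/49) is about 229, leaving room above 200.\<close>
    with tail pos have "200 * b (n - 1) \<le> b n" by simp
    with pos show ?thesis by simp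
  qed
qed

text \<open>The complex recursion is moved to an integer sequence, where the factor 240 can be
  divided out, and then to the reals, where the growth lemma gives the sign.\<close>

theorem beta4_sign_and_divisibility:
  assumes "n > 0"
  shows "\<exists>m::nat. m \<ge> 1 \<and> (-1) ^ n * beta4 n = 240 * of_nat m"
proof -
  obtain c :: "nat \<Rightarrow> int" where c: "\<And>n. beta4 n = of_int (c n)"
    using beta4_int by metis
  have crec: "c n = - 240 * (\<Sum>k=1..n. int (divisor_sum 3 k) * c (n - k))" if "n > 0" for n
  proof -
    have "(of_int (c n) :: complex) = of_int (- 240 * (\<Sum>k=1..n. int (divisor_sum 3 k) * c (n - k)))"
      using beta4_rec[OF that] by (simp add: c)
    then show ?thesis by (simp only: of_int_eq_iff)
  qed
  define b where "b n = (- 1) ^ n * real_of_int (c n)" for n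
  have "b n > 0"
  proof (rule signed_recurrence_growth[THEN conjunct1])
    have "(of_int (c 0) :: complex) = of_int 1"
      unfolding c [symmetric] by (simp add: beta4_0)
    then show "b 0 = 1" by (simp only: of_int_eq_iff b_def) simp
  next
    fix n :: nat assume n: "n > 0"
    have "b n = (- 1) ^ n * (- 240 * (\<Sum>k=1..n. real (divisor_sum 3 k) * real_of_int (c (n - k))))"
      unfolding b_def by (subst crec[OF n]) simp
    also have "\<dots> = 240 * (\<Sum>k=1..n. - ((- 1) ^ n) * (real (divisor_sum 3 k) * real_of_int (c (n - k))))"
      unfolding sum_distrib_left by (rule sum.cong) simp_all
    also have "(\<Sum>k=1..n. - ((- 1) ^ n) * (real (divisor_sum 3 k) * real_of_int (c (n - k)))) =
        (\<Sum>k=1..n. (- 1) ^ (k + 1) * real (divisor_sum 3 k) * b (n - k))"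
    proof (rule sum.cong[OF refl])
      fix k assume "k \<in> {1..n}"
      then have "(- 1 :: real) ^ n = (- 1) ^ k * (- 1) ^ (n - k)"
        by (simp flip: power_add)
      then show "- ((- 1) ^ n) * (real (divisor_sum 3 k) * real_of_int (c (n - k))) =
          (- 1) ^ (k + 1) * real (divisor_sum 3 k) * b (n - k)"
        by (simp add: b_def)
    qed
    finally show "b n = 240 * (\<Sum>k=1..n. (- 1) ^ (k + 1) * real (divisor_sum 3 k) * b (n - k))" .
  qed
  moreover have "b n = real_of_int ((- 1) ^ n * c n)"
    by (simp add: b_def)
  ultimately have pos: "(- 1) ^ n * c n > 0"
    by (simp only: of_int_0_less_iff)
  \<comment> \<open>The cofactor of 240 in the recursion; it is positive because the signed
    coefficient is.\<close>
  define m where "m = (- 1) ^ n * (- (\<Sum>k=1..n. int (divisor_sum 3 k) * c (n - k)))"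
  have eq: "(- 1) ^ n * c n = 240 * m"
    unfolding m_def by (subst crec[OF assms]) simp
  have "(- 1) ^ n * beta4 n = of_int (240 * m)"
    unfolding eq [symmetric] by (simp add: c)
  with pos eq show ?thesis
    by (intro exI[of _ "nat m"]) auto
qed

section \<open>Coefficient asymptotics from a zero near the origin\<close>

lemma Theta_conv_fps_deriv: "Theta f = fps_X * fps_deriv f"
proof (rule fps_ext)
  show "fps_nth (Theta f) n = fps_nth (fps_X * fps_deriv f) n" for n
    by (cases n) (auto simp: Theta_def)
qed

lemma Theta_mult: "Theta (f * g) = Theta f * g + f * Theta g"
  by (simp add: Theta_conv_fps_deriv algebra_simps)

lemma fps_conv_radius_Theta: "fps_conv_radius f \<le> fps_conv_radius (Theta f)"
proof -
  have "fps_conv_radius f \<le> min (fps_conv_radius (fps_X :: complex fps)) (fps_conv_radius (fps_deriv f))"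
    using fps_conv_radius_deriv[of f] by simp
  also have "\<dots> \<le> fps_conv_radius (Theta f)"
    unfolding Theta_conv_fps_deriv by (rule fps_conv_radius_mult)
  finally show ?thesis .
qed

text \<open>Each further factor n is an application of \<open>Theta\<close>, which does not shrink
  the radius of the geometric series.\<close>

lemma fps_conv_radius_powers: "fps_conv_radius (Abs_fps (\<lambda>n. of_nat n ^ j) :: complex fps) \<ge> 1"
proof (induction j)
  case 0
  have "conv_radius (\<lambda>n. 1 :: complex) = 1"
    by (rule conv_radius_ratio_limit_nonzero[of _ 1]) auto
  then show ?case by (simp add: fps_conv_radius_def)
next
  case (Suc j)
  have "Abs_fps (\<lambda>n. of_nat n ^ Suc j) = Theta (Abs_fps (\<lambda>n. of_nat n ^ j))"
    by (rule fps_ext) (simp add: Theta_def)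
  then show ?case
    using Suc fps_conv_radius_Theta order.trans by metis
qed

lemma summable_norm_powers:
  fixes q :: complex
  assumes "norm q < 1"
  shows "summable (\<lambda>n. real n ^ j * norm q ^ n)"
proof -
  have "ereal (norm q) < fps_conv_radius (Abs_fps (\<lambda>n. of_nat n ^ j) :: complex fps)"
    using fps_conv_radius_powers[of j] assms by (meson ereal_less(3) less_le_trans)
  from norm_summable_fps[OF this] show ?thesis
    by (simp add: norm_mult norm_power)
qed

lemma fps_conv_radius_ge_1:
  fixes f :: "complex fps"
  assumes bound: "\<And>n. n > 0 \<Longrightarrow> norm (fps_nth f n) \<le> C * real n ^ j"
  shows "fps_conv_radius f \<ge> 1"
  unfolding fps_conv_radius_def
proof (rule conv_radius_geI_ex')
  fix r :: real assume r: "0 < r" "ereal r < 1"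
  then have "norm (complex_of_real r) < 1" by simp
  from summable_mult[OF summable_norm_powers[OF this], of C j]
  show "summable (\<lambda>n. fps_nth f n * complex_of_real r ^ n)"
    by (rule summable_comparison_test'[where N = 1])
       (use r bound in \<open>auto simp: norm_mult norm_power mult.assoc [symmetric] intro!: mult_right_mono\<close>)
qed

lemma divisor_sum_le_power: "divisor_sum l n \<le> n ^ (l + 1)"
proof (cases "n = 0")
  case False
  have "divisor_sum l n \<le> (\<Sum>d=1..n. d ^ l)"
    unfolding divisor_sum_def
    using False dvd_pos_nat[of n] dvd_imp_le[of _ n] by (intro sum_mono2) (auto simp: Suc_le_eq)
  also have "\<dots> \<le> (\<Sum>d=1..n. n ^ l)"
    by (intro sum_mono power_mono) auto
  finally show ?thesis by simp
qed (simp add: divisor_sum_def)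

lemma of_nat_divisor_sum_le: "real (divisor_sum l n) \<le> real n ^ (l + 1)"
  using of_nat_mono[OF divisor_sum_le_power[of l n], where 'a = real] by simp

lemma fps_conv_radius_E4: "fps_conv_radius E4 \<ge> 1"
  by (rule fps_conv_radius_ge_1[of _ 240 4])
     (use of_nat_divisor_sum_le[of 3] in \<open>auto simp: E4_def norm_mult\<close>)

lemma fps_conv_radius_E6: "fps_conv_radius E6 \<ge> 1"
  by (rule fps_conv_radius_ge_1[of _ 504 6])
     (use of_nat_divisor_sum_le[of 5] in \<open>auto simp: E6_def norm_mult\<close>)

text \<open>A zero \<open>q\<close> of \<open>E4\<close> this close to the origin can be split off: \<open>E4 = (1 - X / q) H\<close>, where
  the coefficients of \<open>H\<close> beyond the constant term are so small that \<open>1 / H\<close> converges on the disc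
  of radius \<open>1 / 64\<close>. Hence \<open>beta4 n * q ^ n\<close> is the partial sum of the series of \<open>1 / H\<close> at \<open>q\<close>.\<close>

locale E4_zero =
  fixes q :: complex
  assumes q_nz: "q \<noteq> 0" and q_small: "norm q \<le> 1 / 128" and zero: "eval_fps E4 q = 0"
begin

text \<open>The remainder of the series of \<open>E4\<close> at \<open>q\<close> from index n on,
  divided by q^n; for n = 0 it is the value at \<open>q\<close>.\<close>

definition tail :: "nat \<Rightarrow> complex" where
  "tail n = (\<Sum>j. fps_nth E4 (n + j) * q ^ j)"

text \<open>Formal division by 1 - X / q gives the coefficients sum over i <= n of a(i) q^(i - n),
  where a(i) are those of \<open>E4\<close>. As the full sum vanishes, these are the negated
  remainders, a form in which they are visibly small.\<close>

definition cofactor :: "complex fps" where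
  "cofactor = Abs_fps (\<lambda>n. - q * tail (Suc n))"

lemma q_less_radius: "ereal (norm q) < fps_conv_radius E4"
proof -
  have "ereal (norm q) < 1" using q_small by simp
  then show ?thesis using fps_conv_radius_E4 by (rule less_le_trans)
qed

lemma tail_0: "tail 0 = 0"
  using zero by (simp add: tail_def eval_fps_def)

lemma tail_summable: "summable (\<lambda>j. fps_nth E4 (n + j) * q ^ j)"
proof -
  have "summable (\<lambda>j. fps_nth E4 (j + n) * q ^ (j + n))"
    using summable_fps[OF q_less_radius] by (rule summable_ignore_initial_segment)
  from summable_mult[OF this, of "inverse (q ^ n)"] show ?thesis
    using q_nz by (simp add: power_add add.commute field_simps)
qed

text \<open>For n > 0, this is the comparison of n-th coefficients in
  \<open>E4_factor\<close>.\<close>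

lemma tail_Suc: "tail n = fps_nth E4 n + q * tail (Suc n)"
proof -
  have "tail n = fps_nth E4 n + (\<Sum>j. fps_nth E4 (n + Suc j) * q ^ Suc j)"
    unfolding tail_def using suminf_split_head[OF tail_summable[of n]] by simp
  also have "(\<Sum>j. fps_nth E4 (n + Suc j) * q ^ Suc j) = (\<Sum>j. q * (fps_nth E4 (Suc n + j) * q ^ j))"
    by (simp add: mult_ac)
  also have "\<dots> = q * tail (Suc n)"
    unfolding tail_def by (rule suminf_mult[OF tail_summable])
  finally show ?thesis .
qed

lemma cofactor_0: "fps_nth cofactor 0 = 1"
proof -
  \<comment> \<open>This is where the vanishing of \<open>E4\<close> at \<open>q\<close>
    enters.\<close>
  have "1 + q * tail (Suc 0) = 0" using tail_Suc[of 0] tail_0 by simp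
  then have "- (q * tail (Suc 0)) = 1" by (metis add.inverse_unique minus_minus)
  then show ?thesis by (simp add: cofactor_def)
qed

lemma E4_factor: "E4 = (1 - fps_const (1 / q) * fps_X) * cofactor"
proof (rule fps_ext)
  fix n
  show "fps_nth E4 n = fps_nth ((1 - fps_const (1 / q) * fps_X) * cofactor) n"
  proof (cases n)
    case 0
    then show ?thesis using cofactor_0 by (simp add: left_diff_distrib)
  next
    case (Suc m)
    then show ?thesis using tail_Suc[of n] q_nz
      by (simp add: cofactor_def left_diff_distrib mult.assoc)
  qed
qed

text \<open>Only coefficients of \<open>E4\<close> from index 2 on occur, so
  \<open>divisor_sum_3_le\<close> applies: 2160 = 240 * 9, the ratio is 4 / 128 = 1/32, and 2160 /
  128 * 32/31 < 18.\<close>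

lemma norm_cofactor_le: "norm (fps_nth cofactor (Suc n)) \<le> 18 * 4 ^ n"
proof -
  have "norm (tail (n + 2)) \<le> (\<Sum>j. 2160 * 4 ^ n * (1 / 32) ^ j)"
    unfolding tail_def
  proof (rule norm_suminf_le)
    fix j
    have "real (divisor_sum 3 (n + 2 + j)) \<le> 9 * 4 ^ (n + j)"
      using of_nat_mono[OF divisor_sum_3_le[of "n + 2 + j"], where 'a = real] by simp
    moreover have "norm q ^ j \<le> (1 / 128) ^ j"
      using q_small by (intro power_mono) auto
    ultimately have "240 * real (divisor_sum 3 (n + 2 + j)) * norm q ^ j \<le> 240 * (9 * 4 ^ (n + j)) * (1 / 128) ^ j"
      by (intro mult_mono) auto
    also have "\<dots> = 2160 * 4 ^ n * (4 * (1 / 128)) ^ j"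
      unfolding power_mult_distrib power_add by simp
    finally show "norm (fps_nth E4 (n + 2 + j) * q ^ j) \<le> 2160 * 4 ^ n * (1 / 32) ^ j"
      by (simp add: E4_def norm_mult norm_power)
  qed (intro summable_mult summable_geometric; simp)
  also have "\<dots> = 2160 * 4 ^ n * (32 / 31)"
    by (subst suminf_mult) (simp_all add: suminf_geometric)
  finally have "norm q * norm (tail (n + 2)) \<le> (1 / 128) * (2160 * 4 ^ n * (32 / 31))"
    using q_small by (intro mult_mono) auto
  also have "\<dots> \<le> 18 * 4 ^ n" by simp
  finally show ?thesis by (simp add: cofactor_def norm_mult)
qed

text \<open>The base 64 puts the circle of convergence strictly outside |q| <= 1/128. It closes the
  induction because 18/64 times the geometric sum with ratio 4/64 is at most 9/32 * 16/15 =
  3/10.\<close>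

lemma norm_inverse_cofactor_le: "norm (fps_nth (inverse cofactor) n) \<le> 64 ^ n"
proof (induction n rule: less_induct)
  case (less n)
  show ?case
  proof (cases "n = 0")
    case True
    then show ?thesis by (simp add: cofactor_0)
  next
    case False
    let ?g = "fps_nth (inverse cofactor)" and ?h = "fps_nth cofactor"
    have "cofactor * inverse cofactor = 1"
      by (rule inverse_mult_eq_1') (simp add: cofactor_0)
    then have "0 = fps_nth (cofactor * inverse cofactor) n"
      using False by simp
    also have "\<dots> = ?g n + (\<Sum>k=1..n. ?h k * ?g (n - k))"
      by (simp add: fps_mult_nth sum.atLeast_Suc_atMost cofactor_0)
    finally have "norm (?g n) = norm (\<Sum>k=1..n. ?h k * ?g (n - k))"
      by (metis add_eq_0_iff norm_minus_cancel)
    also have "\<dots> \<le> (\<Sum>k=1..n. 64 ^ n * (9 / 32) * (1 / 16) ^ (k - 1))"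
    proof (rule sum_norm_le)
      fix k assume k: "k \<in> {1..n}"
      then obtain j where j: "k = Suc j" by (cases k) auto
      have "norm (?h k * ?g (n - k)) \<le> (18 * 4 ^ j) * 64 ^ (n - k)"
        unfolding norm_mult using norm_cofactor_le[of j] less.IH[of "n - k"] k j
        by (intro mult_mono) auto
      also have "\<dots> = 64 ^ n * (9 / 32) * (1 / 16) ^ (k - 1)"
      proof -
        from k j have "n = Suc j + (n - k)" by auto
        then have "(64::real) ^ n = 64 * 64 ^ j * 64 ^ (n - k)" by (metis power_Suc power_add)
        moreover have "(64::real) ^ j = 4 ^ j * 16 ^ j" by (simp flip: power_mult_distrib)
        ultimately show ?thesis by (simp add: j power_one_over)
      qed
      finally show "norm (?h k * ?g (n - k)) \<le> 64 ^ n * (9 / 32) * (1 / 16) ^ (k - 1)" .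
    qed
    also have "\<dots> = 64 ^ n * (9 / 32) * (\<Sum>j<n. (1 / 16) ^ j)"
      unfolding sum_distrib_left
      by (rule sum.reindex_bij_witness[where i = Suc and j = "\<lambda>k. k - 1"]) auto
    also have "\<dots> \<le> 64 ^ n * (9 / 32) * (16 / 15)"
      by (intro mult_left_mono, subst sum_gp_strict) (auto simp: field_simps)
    also have "\<dots> \<le> 64 ^ n" by simp
    finally show ?thesis .
  qed
qed

lemma conv_radius_ge_64th:
  fixes f :: "complex fps"
  assumes "\<And>n. norm (fps_nth f n) \<le> C * 64 ^ n"
  shows "ereal (1 / 64) \<le> fps_conv_radius f"
  unfolding fps_conv_radius_def
proof (rule conv_radius_geI_ex')
  fix r :: real assume r: "0 < r" "ereal r < ereal (1 / 64)"
  have "summable (\<lambda>n. C * (64 * r) ^ n)"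
    using r by (intro summable_mult summable_geometric) auto
  then show "summable (\<lambda>n. fps_nth f n * complex_of_real r ^ n)"
    by (rule summable_comparison_test'[where N = 0])
       (use r assms in \<open>auto simp: norm_mult norm_power power_mult_distrib mult.assoc [symmetric] intro!: mult_right_mono\<close>)
qed

lemma q_less_radius_inverse_cofactor: "ereal (norm q) < fps_conv_radius (inverse cofactor)"
proof -
  have "ereal (norm q) < ereal (1 / 64)" using q_small by simp
  also have "\<dots> \<le> fps_conv_radius (inverse cofactor)"
    by (rule conv_radius_ge_64th[of _ 1]) (simp add: norm_inverse_cofactor_le)
  finally show ?thesis .
qed

lemma q_less_radius_cofactor: "ereal (norm q) < fps_conv_radius cofactor"
proof -
  have "norm (fps_nth cofactor n) \<le> 18 * 64 ^ n" for n
  proof (cases n)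
    case (Suc m)
    have "18 * 4 ^ m \<le> (18 * 64 ^ m :: real)" by (intro mult_left_mono power_mono) auto
    also have "\<dots> \<le> 18 * 64 ^ Suc m" by simp
    finally show ?thesis using norm_cofactor_le[of m] Suc by simp
  qed (simp add: cofactor_0)
  then have "ereal (1 / 64) \<le> fps_conv_radius cofactor" by (rule conv_radius_ge_64th)
  moreover have "ereal (norm q) < ereal (1 / 64)" using q_small by simp
  ultimately show ?thesis by (rule less_le_trans[rotated])
qed

lemma eval_cofactor_mult_inverse: "eval_fps cofactor q * eval_fps (inverse cofactor) q = 1"
proof -
  have "cofactor * inverse cofactor = 1"
    by (rule inverse_mult_eq_1') (simp add: cofactor_0)
  then show ?thesis
    using eval_fps_mult[OF q_less_radius_cofactor q_less_radius_inverse_cofactor] by simp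
qed

text \<open>By the product rule for E4 = L H with L = 1 - X / q: at \<open>q\<close> the factor L
  vanishes and Theta L = - X / q takes the value -1.\<close>

lemma eval_Theta_E4: "eval_fps (Theta E4) q = - eval_fps cofactor q"
proof -
  let ?L = "1 - fps_const (1 / q) * fps_X"
  have ThetaL: "Theta ?L = - fps_const (1 / q) * fps_X"
    by (simp add: Theta_conv_fps_deriv mult.commute)
  have rL: "fps_conv_radius ?L = \<infinity>"
    using fps_conv_radius_diff[of 1 "fps_const (1 / q) * fps_X"]
      fps_conv_radius_mult[of "fps_const (1 / q)" fps_X] by simp
  have rTL: "fps_conv_radius (Theta ?L) = \<infinity>"
    using fps_conv_radius_Theta[of ?L] rL by simp
  have rTh: "ereal (norm q) < fps_conv_radius (Theta cofactor)"
    using q_less_radius_cofactor fps_conv_radius_Theta by (rule less_le_trans)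
  have eL: "eval_fps ?L q = 0"
    using q_nz fps_conv_radius_mult[of "fps_const (1 / q)" fps_X]
    by (simp add: eval_fps_diff eval_fps_mult)
  have eTL: "eval_fps (Theta ?L) q = - 1"
    unfolding ThetaL fps_const_neg using q_nz by (simp add: eval_fps_mult)
  have "eval_fps (Theta E4) q = eval_fps (Theta ?L * cofactor + ?L * Theta cofactor) q"
    by (subst E4_factor) (simp only: Theta_mult)
  also have "\<dots> = eval_fps (Theta ?L * cofactor) q + eval_fps (?L * Theta cofactor) q"
    by (rule eval_fps_add; rule less_le_trans[OF _ fps_conv_radius_mult])
       (use rL rTL rTh q_less_radius_cofactor in auto)
  also have "\<dots> = eval_fps (Theta ?L) q * eval_fps cofactor q + eval_fps ?L q * eval_fps (Theta cofactor) q"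
    using rL rTL rTh q_less_radius_cofactor by (simp add: eval_fps_mult)
  finally show ?thesis by (simp add: eL eTL)
qed

lemma beta4_partial_sum: "beta4 n * q ^ n = (\<Sum>k\<le>n. fps_nth (inverse cofactor) k * q ^ k)"
proof -
  have "inverse (1 - fps_const (1 / q) * fps_X) = Abs_fps (\<lambda>n. (1 / q) ^ n)"
  proof (rule fps_inverse_unique, rule fps_ext)
    show "fps_nth ((1 - fps_const (1 / q) * fps_X) * Abs_fps (\<lambda>n. (1 / q) ^ n)) n = fps_nth 1 n" for n
      by (cases n) (auto simp: left_diff_distrib mult.assoc)
  qed
  then have "1 / E4 = inverse cofactor * Abs_fps (\<lambda>n. (1 / q) ^ n)"
    by (subst fps_divide_unit, simp) (subst E4_factor, simp add: fps_inverse_mult mult.commute)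
  then have "beta4 n * q ^ n = (\<Sum>k=0..n. fps_nth (inverse cofactor) k * (1 / q) ^ (n - k)) * q ^ n"
    by (simp add: beta4_def fps_mult_nth)
  also have "\<dots> = (\<Sum>k\<le>n. fps_nth (inverse cofactor) k * q ^ k)"
    unfolding sum_distrib_right atLeast0AtMost
  proof (rule sum.cong[OF refl])
    fix k assume "k \<in> {..n}"
    then have "q ^ n = q ^ (n - k) * q ^ k" by (simp flip: power_add)
    then show "fps_nth (inverse cofactor) k * (1 / q) ^ (n - k) * q ^ n = fps_nth (inverse cofactor) k * q ^ k"
      using q_nz by (simp add: power_one_over)
  qed
  finally show ?thesis .
qed

text \<open>The partial sums in \<open>beta4_partial_sum\<close> converge to the value of
  \<open>inverse cofactor\<close> at \<open>q\<close>, the reciprocal of that of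
  \<open>cofactor\<close>, which is minus the value of \<open>Theta E4\<close>.\<close>

theorem beta4_asymp: "beta4 \<sim>[sequentially] (\<lambda>n. - (1 / eval_fps (Theta E4) q) * q powi (- int n))"
proof (rule asymp_equivI')
  have nz: "eval_fps cofactor q \<noteq> 0"
    using eval_cofactor_mult_inverse by auto
  have "(\<lambda>n. \<Sum>k\<le>n. fps_nth (inverse cofactor) k * q ^ k) \<longlonglongrightarrow> eval_fps (inverse cofactor) q"
    using sums_eval_fps[OF q_less_radius_inverse_cofactor] by (simp add: sums_def_le)
  then have "(\<lambda>n. beta4 n * q ^ n * eval_fps cofactor q) \<longlonglongrightarrow> eval_fps (inverse cofactor) q * eval_fps cofactor q"
    unfolding beta4_partial_sum by (intro tendsto_intros)
  moreover have "beta4 n / (- (1 / eval_fps (Theta E4) q) * q powi (- int n)) = beta4 n * q ^ n * eval_fps cofactor q" for n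
    using nz q_nz by (simp add: eval_Theta_E4 power_int_minus field_simps)
  ultimately show "(\<lambda>n. beta4 n / (- (1 / eval_fps (Theta E4) q) * q powi (- int n))) \<longlonglongrightarrow> 1"
    using eval_cofactor_mult_inverse by (simp add: mult.commute)
qed

end

section \<open>The reflection formula for the third polygamma function\<close>

text \<open>Allows an identity on an open set to be differentiated on both sides.\<close>

lemma DERIV_unique_on_open:
  fixes f g :: "complex \<Rightarrow> complex"
  assumes "open S" "z \<in> S" "\<And>w. w \<in> S \<Longrightarrow> f w = g w"
    and "(f has_field_derivative f') (at z)" "(g has_field_derivative g') (at z)"
  shows "f' = g'"
proof -
  have "(g has_field_derivative f') (at z)"
    using assms has_field_derivative_transform_within_open by metis
  then show ?thesis using assms(5) DERIV_unique by blast
qed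

lemma sin_pi_nonzero: "z \<notin> \<int> \<Longrightarrow> sin (of_real pi * z) \<noteq> 0" for z :: complex
proof
  assume "z \<notin> \<int>" "sin (of_real pi * z) = 0"
  then obtain n :: int where "of_real pi * z = of_real (of_int n * pi)"
    unfolding Complex_Transcendental.sin_eq_0 by blast
  then have "z = of_int n" by (simp add: mult.commute)
  with \<open>z \<notin> \<int>\<close> show False by simp
qed

lemma one_minus_not_Ints: "z \<notin> \<int> \<Longrightarrow> 1 - z \<notin> \<int>" for z :: complex
  by (metis Ints_1 Ints_diff diff_diff_eq2 add_diff_cancel_left')

lemma not_Ints_imp_not_nonpos_Ints: "z \<notin> \<int> \<Longrightarrow> z \<notin> \<int>\<^sub>\<le>\<^sub>0" for z :: complex
  using nonpos_Ints_Int by blast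

text \<open>The family is closed under differentiation, only \<open>c\<close> changing sign, so the
  reflection formula can be differentiated repeatedly.\<close>

lemma has_field_derivative_Polygamma_diff:
  assumes "z \<notin> \<int>"
  shows "((\<lambda>z. c * Polygamma n (1 - z) + d * Polygamma n z) has_field_derivative
           (- c * Polygamma (Suc n) (1 - z) + d * Polygamma (Suc n) z)) (at (z :: complex))"
  by (rule derivative_eq_intros refl | use assms one_minus_not_Ints not_Ints_imp_not_nonpos_Ints in force)+

text \<open>The derivative of rGamma(z) rGamma(1 - z) = sin(pi z) / pi, divided by that
  product.\<close>

lemma Digamma_reflection:
  assumes z: "z \<notin> \<int>"
  shows "Digamma (1 - z) - Digamma z = of_real pi * cot (of_real pi * (z::complex))"
proof -
  have "(\<lambda>z. rGamma z * rGamma (1 - z)) = (\<lambda>z::complex. sin (of_real pi * z) / of_real pi)"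
    by (simp add: rGamma_reflection_complex)
  moreover have "((\<lambda>z. rGamma z * rGamma (1 - z)) has_field_derivative
      rGamma z * rGamma (1 - z) * (Digamma (1 - z) - Digamma z)) (at z)"
  proof -
    have 1: "(rGamma has_field_derivative - rGamma z * Digamma z) (at z)"
      using z not_Ints_imp_not_nonpos_Ints by (intro has_field_derivative_rGamma_no_nonpos_int) blast
    have "(rGamma has_field_derivative - rGamma (1 - z) * Digamma (1 - z)) (at (1 - z))"
      using z one_minus_not_Ints not_Ints_imp_not_nonpos_Ints
      by (intro has_field_derivative_rGamma_no_nonpos_int) blast
    moreover have "((\<lambda>z. 1 - z) has_field_derivative - 1) (at z)"
      by (auto intro!: derivative_eq_intros)
    ultimately have "((\<lambda>z. rGamma (1 - z)) has_field_derivative - rGamma (1 - z) * Digamma (1 - z) * - 1) (at z)"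
      by (rule DERIV_chain2)
    from DERIV_mult[OF 1 this] show ?thesis by (simp add: algebra_simps)
  qed
  ultimately have "((\<lambda>z::complex. sin (of_real pi * z) / of_real pi) has_field_derivative
      rGamma z * rGamma (1 - z) * (Digamma (1 - z) - Digamma z)) (at z)"
    by metis
  moreover have "((\<lambda>z::complex. sin (of_real pi * z) / of_real pi) has_field_derivative cos (of_real pi * z)) (at z)"
    by (auto intro!: derivative_eq_intros)
  ultimately have "rGamma z * rGamma (1 - z) * (Digamma (1 - z) - Digamma z) = cos (of_real pi * z)"
    by (rule DERIV_unique)
  then show ?thesis
    using sin_pi_nonzero[OF z] by (simp add: rGamma_reflection_complex cot_def field_simps)
qed

text \<open>Written with 1 + cot^2, so that all higher derivatives stay polynomials in cot.\<close>

lemma has_field_derivative_cot_pi: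
  assumes "z \<notin> \<int>"
  shows "((\<lambda>z::complex. cot (of_real pi * z)) has_field_derivative
     - of_real pi * (1 + cot (of_real pi * z) ^ 2)) (at z)"
proof -
  have nz: "sin (of_real pi * z) \<noteq> 0" using sin_pi_nonzero[OF assms] .
  have "((\<lambda>z::complex. cot (of_real pi * z)) has_field_derivative
     - inverse (sin (of_real pi * z) ^ 2) * of_real pi) (at z)"
    by (rule DERIV_chain2[where f = cot and g = "\<lambda>z. of_real pi * z", OF DERIV_cot[OF nz]]) (auto intro!: derivative_eq_intros)
  moreover have "inverse (sin (of_real pi * z) ^ 2) = 1 + cot (of_real pi * z) ^ 2"
    using nz sin_cos_squared_add[of "of_real pi * z"] by (simp add: cot_def field_simps)
  ultimately show ?thesis by (simp add: mult.commute)
qed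

text \<open>Three differentiations of \<open>Digamma_reflection\<close>, carried out on the open
  complement of the integers.\<close>

lemma Polygamma_3_reflection:
  fixes z :: complex
  assumes z: "z \<notin> \<int>"
  defines "c \<equiv> cot (of_real pi * z)"
  shows "Polygamma 3 z + Polygamma 3 (1 - z) = 2 * of_real pi ^ 4 * (1 + 3 * c ^ 2) * (1 + c ^ 2)"
proof -
  have op: "open (- \<int> :: complex set)" by (simp add: open_Compl)
  let ?c = "\<lambda>z::complex. cot (of_real pi * z)" and ?p = "of_real pi :: complex"
  note D = has_field_derivative_Polygamma_diff and dc = has_field_derivative_cot_pi
  have 0: "1 * Polygamma 0 (1 - z) + (- 1) * Polygamma 0 z = ?p * ?c z" if "z \<notin> \<int>" for z :: complex
    using Digamma_reflection[OF that] by simp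
  have 1: "- 1 * Polygamma 1 (1 - z) + (- 1) * Polygamma 1 z = - (?p ^ 2) * (1 + ?c z ^ 2)"
    if "z \<notin> \<int>" for z :: complex
  proof (rule DERIV_unique_on_open[OF op, of z])
    show "((\<lambda>z. 1 * Polygamma 0 (1 - z) + (- 1) * Polygamma 0 z) has_field_derivative
        - 1 * Polygamma 1 (1 - z) + (- 1) * Polygamma 1 z) (at z)"
      using D[OF that, of 1 0 "- 1"] by simp
    show "((\<lambda>z. ?p * ?c z) has_field_derivative - (?p ^ 2) * (1 + ?c z ^ 2)) (at z)"
      by (rule derivative_eq_intros dc that refl | simp add: power2_eq_square algebra_simps)+
  qed (use that 0 in auto)
  have 2: "1 * Polygamma 2 (1 - z) + (- 1) * Polygamma 2 z = 2 * ?p ^ 3 * (?c z + ?c z ^ 3)"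
    if "z \<notin> \<int>" for z :: complex
  proof (rule DERIV_unique_on_open[OF op, of z])
    show "((\<lambda>z. - 1 * Polygamma 1 (1 - z) + (- 1) * Polygamma 1 z) has_field_derivative
        1 * Polygamma 2 (1 - z) + (- 1) * Polygamma 2 z) (at z)"
      using D[OF that, of "- 1" 1 "- 1"] by (simp add: numeral_2_eq_2)
    show "((\<lambda>z. - (?p ^ 2) * (1 + ?c z ^ 2)) has_field_derivative 2 * ?p ^ 3 * (?c z + ?c z ^ 3)) (at z)"
      by (rule derivative_eq_intros dc that refl | simp add: eval_nat_numeral algebra_simps)+
  qed (use that 1 in auto)
  have "- 1 * Polygamma 3 (1 - z) + (- 1) * Polygamma 3 z = - (2 * ?p ^ 4 * (1 + 3 * ?c z ^ 2) * (1 + ?c z ^ 2))"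
  proof (rule DERIV_unique_on_open[OF op, of z])
    show "((\<lambda>z. 1 * Polygamma 2 (1 - z) + (- 1) * Polygamma 2 z) has_field_derivative
        - 1 * Polygamma 3 (1 - z) + (- 1) * Polygamma 3 z) (at z)"
      using D[OF z, of 1 2 "- 1"] by (simp add: eval_nat_numeral)
    show "((\<lambda>z. 2 * ?p ^ 3 * (?c z + ?c z ^ 3)) has_field_derivative
        - (2 * ?p ^ 4 * (1 + 3 * ?c z ^ 2) * (1 + ?c z ^ 2))) (at z)"
      by (rule derivative_eq_intros dc z refl | simp add: eval_nat_numeral algebra_simps)+
  qed (use z 2 in auto)
  then show ?thesis unfolding c_def by (simp add: algebra_simps)
qed

section \<open>Sums of inverse fourth powers: zeta(4) and the Lipschitz formula\<close>

lemma sums_inverse_power4_shifted: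
  fixes z :: complex
  assumes "z \<notin> \<int>"
  shows "(\<lambda>k. inverse ((z + of_nat k) ^ 4)) sums (Polygamma 3 z / 6)"
proof -
  have "z \<noteq> 0" using assms by auto
  then show ?thesis using Polygamma_LIMSEQ[of z 3] by (simp add: fact_numeral)
qed

text \<open>At z = 1/2 the cotangent vanishes and the reflection formula gives the sum over odd
  integers, pi^4 / 96. Splitting into odd and even terms then gives Z = pi^4 / 96 + Z / 16.\<close>

lemma zeta_4: "(\<lambda>n. inverse (of_nat (Suc n) ^ 4) :: complex) sums (of_real pi ^ 4 / 90)"
proof -
  have half: "(1/2 :: complex) \<notin> \<int>"
    using fraction_not_in_Ints[of 2 1, where 'a = complex] by simp
  have "Polygamma 3 (1/2 :: complex) = of_real pi ^ 4"
    using Polygamma_3_reflection[OF half] by (simp add: cot_def cos_of_real_pi_half)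
  with sums_inverse_power4_shifted[OF half]
  have "(\<lambda>k. inverse ((1/2 + of_nat k) ^ 4) :: complex) sums (of_real pi ^ 4 / 6)" by simp
  from sums_mult[OF this, of "1/16"]
  have half_sum: "(\<lambda>k. 1/16 * inverse ((1/2 + of_nat k) ^ 4) :: complex) sums (of_real pi ^ 4 / 96)" by simp
  have odd: "(\<lambda>k. inverse (of_nat (2 * k + 1) ^ 4) :: complex) sums (of_real pi ^ 4 / 96)"
  proof -
    have *: "inverse (of_nat (2 * k + 1) ^ 4) = (1/16) * inverse ((1/2 + of_nat k :: complex) ^ 4)" for k
    proof -
      have "(of_nat (2 * k + 1) :: complex) = 2 * (1/2 + of_nat k)" by simp
      then show ?thesis by (simp only: power_mult_distrib inverse_mult_distrib) simp
    qed
    show ?thesis unfolding * by (rule half_sum)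
  qed
  obtain Z :: complex where Z: "(\<lambda>n. inverse (of_nat (Suc n) ^ 4)) sums Z"
    using Polygamma_converges'[of "1::complex" 4] by (auto simp: summable_def add.commute)
  have "(\<lambda>k. \<Sum>n = k * 2..<k * 2 + 2. inverse (of_nat (Suc n) ^ 4)) sums Z"
    by (rule sums_group[OF Z]) simp
  moreover have "(\<Sum>n = k * 2..<k * 2 + 2. inverse (of_nat (Suc n) ^ 4) :: complex) =
      inverse (of_nat (2 * k + 1) ^ 4) + (1/16) * inverse (of_nat (Suc k) ^ 4)" for k
  proof -
    have "{k * 2..<k * 2 + 2} = {2 * k, 2 * k + 1}" by auto
    moreover have "(of_nat (Suc (2 * k + 1)) :: complex) = 2 * of_nat (Suc k)" by simp
    ultimately show ?thesis
      by (simp add: power_mult_distrib del: of_nat_Suc)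
  qed
  ultimately have "(\<lambda>k. inverse (of_nat (2 * k + 1) ^ 4) + (1/16) * inverse (of_nat (Suc k) ^ 4)) sums Z"
    by simp
  moreover have "(\<lambda>k. inverse (of_nat (2 * k + 1) ^ 4) + (1/16) * inverse (of_nat (Suc k) ^ 4))
      sums (of_real pi ^ 4 / 96 + 1/16 * Z)"
    by (intro sums_add odd sums_mult Z)
  ultimately have "Z = of_real pi ^ 4 / 96 + 1/16 * Z" by (rule sums_unique2)
  then have "Z = of_real pi ^ 4 / 90" by (simp add: field_simps)
  with Z show ?thesis by simp
qed

text \<open>An index shift gives S(j) = q * sum of (k + 1)^j q^k for j > 0, the term k = 0 being
  zero; binomial expansion makes this a linear equation for S(j) in terms of lower moments.\<close>

lemma sums_cubes_powser:
  fixes q :: complex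
  assumes q: "norm q < 1"
  shows "(\<lambda>k. of_nat k ^ 3 * q ^ k) sums (q * (1 + 4 * q + q ^ 2) / (1 - q) ^ 4)"
proof -
  define S where "S j = (\<Sum>k. of_nat k ^ j * q ^ k)" for j :: nat
  have sm: "(\<lambda>k. of_nat k ^ j * q ^ k) sums S j" for j
  proof -
    have "summable (\<lambda>k. of_nat k ^ j * q ^ k)"
      using summable_norm_powers[OF q, of j] by (intro summable_norm_cancel[of "\<lambda>k. of_nat k ^ j * q ^ k"]) (simp add: norm_mult norm_power)
    then show ?thesis unfolding S_def by (rule summable_sums)
  qed
  have shift: "(\<lambda>k. of_nat (Suc k) ^ j * q ^ k) sums T \<Longrightarrow> j > 0 \<Longrightarrow> S j = q * T" for j T
  proof -
    assume T: "(\<lambda>k. of_nat (Suc k) ^ j * q ^ k) sums T" and j: "j > 0"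
    have "(\<lambda>k. of_nat (Suc k) ^ j * q ^ Suc k) sums (q * T)"
      using sums_mult[OF T, of q] by (simp add: mult_ac)
    moreover have "(\<lambda>k. of_nat (Suc k) ^ j * q ^ Suc k) sums S j"
      using sm[of j] j by (subst sums_Suc_iff) (simp add: zero_power)
    ultimately show ?thesis by (metis sums_unique2)
  qed
  have nz: "1 - q \<noteq> 0" using q by auto
  have S0: "S 0 = 1 / (1 - q)"
    using sm[of 0] geometric_sums[OF q] by (simp add: sums_unique2)
  have S1: "S 1 = q * (S 1 + S 0)"
    by (rule shift) (use sums_add[OF sm[of 1] sm[of 0]] in \<open>simp_all add: algebra_simps\<close>)
  have S2: "S 2 = q * (S 2 + (2 * S 1 + S 0))"
    by (rule shift)
       (use sums_add[OF sm[of 2] sums_add[OF sums_mult[OF sm[of 1], of 2] sm[of 0]]] in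
         \<open>simp_all add: algebra_simps power2_eq_square\<close>)
  have S3: "S 3 = q * (S 3 + (3 * S 2 + (3 * S 1 + S 0)))"
    by (rule shift)
       (use sums_add[OF sm[of 3] sums_add[OF sums_mult[OF sm[of 2], of 3] sums_add[OF sums_mult[OF sm[of 1], of 3] sm[of 0]]]] in
         \<open>simp_all add: algebra_simps eval_nat_numeral\<close>)
  have S1': "S 1 = q / (1 - q) ^ 2"
  proof -
    have "S 1 * (1 - q) = q * S 0" using S1 by (simp add: algebra_simps)
    then show ?thesis unfolding S0 using nz by (simp add: divide_simps power2_eq_square mult.assoc)
  qed
  have S2': "S 2 = q * (1 + q) / (1 - q) ^ 3"
  proof -
    have "S 2 * (1 - q) = q * (2 * S 1 + S 0)" using S2 by (simp add: algebra_simps)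
    then show ?thesis unfolding S1' S0 using nz
      by (simp add: divide_simps eval_nat_numeral) (simp add: algebra_simps)
  qed
  have "S 3 = q * (1 + 4 * q + q ^ 2) / (1 - q) ^ 4"
  proof -
    have "S 3 * (1 - q) = q * (3 * S 2 + (3 * S 1 + S 0))" using S3 by (simp add: algebra_simps)
    then show ?thesis unfolding S2' S1' S0 using nz
      by (simp add: divide_simps eval_nat_numeral) (simp add: algebra_simps)
  qed
  with sm[of 3] show ?thesis by simp
qed

text \<open>The left side is the sum of (z + n)^(-4) over all integers n: the first summand covers n
  >= 0, the second n < 0. With cot(pi z) = i (q + 1) / (q - 1), the reflection formula and the power
  series of cubes become the same rational function of \<open>q\<close>.\<close>

lemma lipschitz_formula:
  fixes z :: complex
  assumes z: "Im z > 0"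
  defines "q \<equiv> exp (2 * of_real pi * \<i> * z)"
  shows "Polygamma 3 z / 6 + Polygamma 3 (1 - z) / 6 = 8 * of_real pi ^ 4 / 3 * (\<Sum>k. of_nat k ^ 3 * q ^ k)"
proof -
  have zI: "z \<notin> \<int>" using z by (auto elim!: Ints_cases)
  have q: "norm q < 1" using z by (simp add: q_def)
  have nz: "1 - q \<noteq> 0" using q by auto
  define e where "e = exp (\<i> * (of_real pi * z))"
  have e0: "e \<noteq> 0" by (simp add: e_def)
  have qe: "q = e ^ 2" unfolding q_def e_def exp_double [symmetric] by (simp add: mult_ac)
  have inv: "exp (- (\<i> * (of_real pi * z))) = inverse e" by (simp add: e_def exp_minus)
  have sin: "sin (of_real pi * z) = (e - inverse e) / (2 * \<i>)"
    by (simp add: sin_exp_eq inv flip: e_def)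
  have cos: "cos (of_real pi * z) = (e + inverse e) / 2"
    by (simp add: cos_exp_eq inv flip: e_def)
  define c where "c = cot (of_real pi * z)"
  have e2: "e * e \<noteq> 1" using nz by (auto simp: qe power2_eq_square)
  have c: "c = \<i> * (q + 1) / (q - 1)"
    unfolding c_def cot_def sin cos qe using e0 e2 by (simp add: divide_simps power2_eq_square)
  have c2: "c ^ 2 = - ((q + 1) ^ 2) / (1 - q) ^ 2"
    unfolding c by (simp add: power_divide power_mult_distrib power2_commute[of q 1])
  have "Polygamma 3 z / 6 + Polygamma 3 (1 - z) / 6 = of_real pi ^ 4 / 3 * ((1 + 3 * c ^ 2) * (1 + c ^ 2))"
    using Polygamma_3_reflection[OF zI] by (simp add: c_def field_simps)
  also have "(1 + 3 * c ^ 2) * (1 + c ^ 2) = 8 * (q * (1 + 4 * q + q ^ 2) / (1 - q) ^ 4)"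
    unfolding c2 using nz by (simp add: divide_simps eval_nat_numeral) (simp add: algebra_simps)
  also have "q * (1 + 4 * q + q ^ 2) / (1 - q) ^ 4 = (\<Sum>k. of_nat k ^ 3 * q ^ k)"
    by (rule sums_unique[OF sums_cubes_powser[OF q]])
  finally show ?thesis by simp
qed

section \<open>The Eisenstein lattice sum\<close>

text \<open>Links unordered sums over the integers with ordinary series. Negative integers are
  written - 1 - n, so zero is counted once.\<close>

lemma infsum_int_split:
  fixes f :: "int \<Rightarrow> complex"
  assumes f: "f summable_on UNIV"
    and A: "(\<lambda>n. f (int n)) sums A" and B: "(\<lambda>n. f (- 1 - int n)) sums B"
  shows "infsum f UNIV = A + B"
proof -
  have part: "(f has_sum C) (range g)" if "inj g" "(\<lambda>n. f (g n)) sums C" for g :: "nat \<Rightarrow> int" and C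
  proof -
    have "f summable_on range g" using f by (rule summable_on_subset_banach) simp
    then obtain C' where C': "(f has_sum C') (range g)" by (auto simp: summable_on_def)
    then have "((\<lambda>n. f (g n)) has_sum C') UNIV"
      using has_sum_reindex[OF that(1), of f C'] by (simp add: o_def)
    then have "C' = C" using that(2) has_sum_imp_sums sums_unique2 by blast
    with C' show ?thesis by simp
  qed
  have U: "(UNIV :: int set) = range int \<union> range (\<lambda>n. - 1 - int n)"
  proof -
    have "z \<in> range int \<union> range (\<lambda>n. - 1 - int n)" for z :: int
    proof (cases "z \<ge> 0")
      case True
      then have "z = int (nat z)" by simp
      then show ?thesis by blast
    next
      case False
      then have "z = - 1 - int (nat (- 1 - z))" by simp
      then show ?thesis by blast
    qed
    then show ?thesis by blast
  qed
  have "(f has_sum (A + B)) (range int \<union> range (\<lambda>n. - 1 - int n))"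
    by (rule has_sum_Un_disjoint) (use part[OF _ A] part[OF _ B] in \<open>auto simp: inj_on_def\<close>)
  then show ?thesis unfolding U [symmetric] by (rule infsumI)
qed

lemma summable_on_int_inverse_squares: "(\<lambda>n::int. 1 / (1 + real_of_int n ^ 2)) summable_on UNIV"
proof -
  have nat: "(\<lambda>n::nat. 1 / (1 + real n ^ 2)) summable_on UNIV"
  proof (rule norm_summable_imp_summable_on)
    show "summable (\<lambda>n. norm (1 / (1 + real n ^ 2)))"
      by (rule summable_comparison_test'[OF inverse_power_summable[of 2, where 'a = real], where N = 1])
         (auto simp: field_simps divide_le_eq_1 add_pos_nonneg)
  qed
  let ?f = "\<lambda>n::int. 1 / (1 + real_of_int n ^ 2)"
  have "?f summable_on range int"
    by (subst summable_on_reindex) (use nat in \<open>auto simp: o_def\<close>)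
  moreover have "?f summable_on range (\<lambda>n. - int n)"
    by (subst summable_on_reindex) (use nat in \<open>auto simp: o_def inj_on_def\<close>)
  ultimately have "?f summable_on (range int \<union> range (\<lambda>n. - int n))"
    by (rule summable_on_union)
  moreover have "range int \<union> range (\<lambda>n. - int n) = UNIV"
    by (auto simp: image_iff) (metis int_cases2)
  ultimately show ?thesis by simp
qed

text \<open>At (0, 0) the value is \<open>inverse 0 = 0\<close>, so sums over all pairs are sums
  over the nonzero lattice points.\<close>

definition eisenstein_term :: "int \<times> int \<Rightarrow> complex" where
  "eisenstein_term = (\<lambda>(m, n). inverse ((of_int m * rho + of_int n) ^ 4))"

lemma rho_sq: "rho ^ 2 = rho - 1"
proof -
  have "complex_of_real (sqrt 3) * of_real (sqrt 3) = 3"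
    by (simp flip: of_real_mult)
  then show ?thesis unfolding rho_def power2_eq_square
    by (simp add: algebra_simps)
qed

lemma Re_rho: "Re rho = 1 / 2" and Im_rho: "Im rho = sqrt 3 / 2"
  by (simp_all add: rho_def)

lemma norm_eisenstein_integer: "norm (of_int m * rho + of_int n) ^ 2 = of_int (m ^ 2 + m * n + n ^ 2)"
  by (simp add: cmod_power2 Re_rho Im_rho power_mult_distrib power_divide) (simp add: power2_eq_square algebra_simps)

text \<open>A product majorant reduces summability over the lattice to one variable. With s = m^2 +
  n^2 >= 1, the norm form is at least s / 2, and (1 + m^2) (1 + n^2) <= 3 s^2 = 12 (s /
  2)^2.\<close>

lemma norm_eisenstein_term_le:
  "norm (eisenstein_term (m, n)) \<le> 12 * ((1 / (1 + real_of_int m ^ 2)) * (1 / (1 + real_of_int n ^ 2)))"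
proof (cases "m = 0 \<and> n = 0")
  case True
  then show ?thesis by (simp add: eisenstein_term_def)
next
  case False
  define s where "s = real_of_int m ^ 2 + real_of_int n ^ 2"
  have "1 \<le> m ^ 2 + n ^ 2"
    using False sum_power2_gt_zero_iff[of m n] by linarith
  then have s1: "1 \<le> s" unfolding s_def by (simp flip: of_int_power of_int_add)
  have "0 \<le> (real_of_int m + real_of_int n) ^ 2" by simp
  then have half: "s / 2 \<le> real_of_int (m ^ 2 + m * n + n ^ 2)"
    by (simp add: s_def power2_eq_square algebra_simps)
  have "(1 + real_of_int m ^ 2) * (1 + real_of_int n ^ 2) \<le> 3 * s ^ 2"
  proof -
    have "real_of_int m ^ 2 * real_of_int n ^ 2 \<le> s * s"
      unfolding s_def by (intro mult_mono) auto
    moreover have "1 \<le> s * s" "s \<le> s * s" using s1 mult_mono[OF s1 s1] mult_left_mono[OF s1, of s] by auto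
    moreover have "(1 + real_of_int m ^ 2) * (1 + real_of_int n ^ 2) = 1 + s + real_of_int m ^ 2 * real_of_int n ^ 2"
      by (simp add: s_def algebra_simps)
    ultimately show ?thesis unfolding power2_eq_square by linarith
  qed
  also have "\<dots> = 12 * (s / 2) ^ 2" by (simp add: power_divide)
  also have "\<dots> \<le> 12 * real_of_int (m ^ 2 + m * n + n ^ 2) ^ 2"
    using half s1 by (intro mult_left_mono power_mono) auto
  also have "\<dots> = 12 * norm (of_int m * rho + of_int n) ^ 4"
    unfolding norm_eisenstein_integer [symmetric] by (simp flip: power_mult)
  finally have le: "(1 + real_of_int m ^ 2) * (1 + real_of_int n ^ 2) \<le> 12 * norm (of_int m * rho + of_int n) ^ 4" .
  have pos: "0 < (1 + real_of_int m ^ 2) * (1 + real_of_int n ^ 2)"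
    by (intro mult_pos_pos add_pos_nonneg) auto
  with le have inv_le: "inverse (12 * norm (of_int m * rho + of_int n) ^ 4) \<le> inverse ((1 + real_of_int m ^ 2) * (1 + real_of_int n ^ 2))"
    by (intro le_imp_inverse_le)
  have "norm (eisenstein_term (m, n)) = 12 * inverse (12 * norm (of_int m * rho + of_int n) ^ 4)"
    by (simp add: eisenstein_term_def norm_inverse norm_power)
  also have "\<dots> \<le> 12 * inverse ((1 + real_of_int m ^ 2) * (1 + real_of_int n ^ 2))"
    using inv_le by (intro mult_left_mono) auto
  finally show ?thesis by (simp add: inverse_eq_divide)
qed

lemma eisenstein_term_summable: "eisenstein_term summable_on UNIV"
proof -
  let ?u = "\<lambda>n::int. 1 / (1 + real_of_int n ^ 2)"
  have pos: "?u n > 0" for n by (simp add: add_pos_nonneg)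
  have "(\<lambda>p. norm ((\<lambda>(m, n). 12 * (?u m * ?u n)) p)) summable_on (UNIV \<times> UNIV)"
  proof (subst Infinite_Sum.abs_summable_on_Sigma_iff, intro conjI ballI)
    fix m :: int
    show "(\<lambda>n. norm ((\<lambda>(m, n). 12 * (?u m * ?u n)) (m, n))) summable_on UNIV"
      using summable_on_cmult_right[OF summable_on_int_inverse_squares, of "12 * ?u m"]
      by (simp add: abs_mult add_pos_nonneg abs_of_pos mult.assoc)
  next
    have "(\<Sum>\<^sub>\<infinity>n. norm ((\<lambda>(m, n). 12 * (?u m * ?u n)) (m, n))) = (12 * infsum ?u UNIV) * ?u m" for m
      using infsum_cmult_right[OF summable_on_int_inverse_squares, of "12 * ?u m"]
      by (simp add: abs_mult add_pos_nonneg abs_of_pos mult_ac)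
    then show "(\<lambda>m. norm (\<Sum>\<^sub>\<infinity>n. norm ((\<lambda>(m, n). 12 * (?u m * ?u n)) (m, n)))) summable_on UNIV"
      using summable_on_cmult_right[OF summable_on_int_inverse_squares, of "12 * \<bar>infsum ?u UNIV\<bar>"]
      by (simp add: abs_mult add_pos_nonneg abs_of_pos mult.assoc)
  qed
  then have "(\<lambda>p. norm (eisenstein_term p)) summable_on (UNIV \<times> UNIV)"
    by (rule Infinite_Sum.abs_summable_on_comparison_test)
       (use norm_eisenstein_term_le in \<open>auto intro: order.trans[OF _ abs_ge_self]\<close>)
  then show ?thesis by (simp add: abs_summable_summable)
qed

lemma eisenstein_sum_zero: "infsum eisenstein_term UNIV = 0"
proof -
  have "infsum eisenstein_term UNIV = (\<Sum>\<^sub>\<infinity>p. inverse (rho ^ 4) * eisenstein_term p)"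
  \<comment> \<open>By rho^2 = rho - 1, the map \<open>j\<close> is division by \<open>rho\<close>
    in the coordinates (m, n), and \<open>i\<close> is multiplication by it.\<close>
  proof (rule infsum_reindex_bij_witness[where i = "\<lambda>(m, n). (m + n, - m)" and j = "\<lambda>(m, n). (- n, m + n)"])
    fix p :: "int \<times> int"
    obtain m n where p: "p = (m, n)" by (cases p)
    have "rho * (of_int (- n) * rho + of_int (m + n)) = of_int m * rho + of_int n"
    proof -
      have "rho * (of_int (- n) * rho + of_int (m + n)) = - of_int n * rho ^ 2 + of_int (m + n) * rho"
        by (simp add: algebra_simps power2_eq_square)
      then show ?thesis unfolding rho_sq by (simp add: algebra_simps)
    qed
    then have "inverse (rho ^ 4) * inverse ((of_int (- n) * rho + of_int (m + n)) ^ 4) = inverse ((of_int m * rho + of_int n) ^ 4)"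
      by (metis inverse_mult_distrib power_mult_distrib)
    then show "inverse (rho ^ 4) * eisenstein_term (case p of (m, n) \<Rightarrow> (- n, m + n)) = eisenstein_term p"
      by (simp add: p eisenstein_term_def)
  qed auto
  also have "\<dots> = inverse (rho ^ 4) * infsum eisenstein_term UNIV"
    by (rule infsum_cmult_right) (rule eisenstein_term_summable)
  finally have *: "infsum eisenstein_term UNIV = inverse (rho ^ 4) * infsum eisenstein_term UNIV" .
  have "rho ^ 4 = - rho"
  proof -
    have "rho ^ 4 = (rho ^ 2) ^ 2" by simp
    also have "\<dots> = (rho - 1) ^ 2" unfolding rho_sq ..
    also have "\<dots> = rho ^ 2 - 2 * rho + 1" by (simp add: power2_eq_square algebra_simps)
    also have "\<dots> = - rho" unfolding rho_sq by simp
    finally show ?thesis .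
  qed
  moreover have "inverse (- rho) \<noteq> 1"
  proof
    assume "inverse (- rho) = 1"
    then have "inverse (inverse (- rho)) = inverse 1" by simp
    then have "- rho = 1" by simp
    then have "Re (- rho) = 1" by simp
    then show False by (simp add: Re_rho)
  qed
  ultimately have "inverse (rho ^ 4) \<noteq> 1" by simp
  moreover have "infsum eisenstein_term UNIV = 0 \<or> inverse (rho ^ 4) = 1"
    by (rule mult_cancel_right1[THEN iffD1, OF *])
  ultimately show ?thesis by blast
qed

lemma eisenstein_row_summable: "(\<lambda>n. eisenstein_term (m, n)) summable_on UNIV"
proof -
  have "eisenstein_term summable_on (Pair m ` UNIV)"
    by (rule summable_on_subset_banach[OF eisenstein_term_summable]) simp
  then show ?thesis by (subst (asm) summable_on_reindex) (auto simp: inj_on_def o_def)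
qed

definition eisenstein_row :: "int \<Rightarrow> complex" where
  "eisenstein_row m = (\<Sum>\<^sub>\<infinity>n. eisenstein_term (m, n))"

lemma eisenstein_row_0: "eisenstein_row 0 = of_real pi ^ 4 / 45"
proof -
  have "eisenstein_row 0 = of_real pi ^ 4 / 90 + of_real pi ^ 4 / 90"
    unfolding eisenstein_row_def
  proof (rule infsum_int_split[OF eisenstein_row_summable])
    \<comment> \<open>The added term n = 0 is \<open>inverse 0 = 0\<close>.\<close>
    have "(\<lambda>n. inverse (of_nat n ^ 4) :: complex) sums (of_real pi ^ 4 / 90 + inverse (of_nat 0 ^ 4))"
      by (rule sums_Suc) (rule zeta_4)
    then show "(\<lambda>n. eisenstein_term (0, int n)) sums (of_real pi ^ 4 / 90)"
      by (simp add: eisenstein_term_def)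
    have "(of_int (- 1 - int n) :: complex) = - of_nat (Suc n)" for n by simp
    then have "(of_int (- 1 - int n) :: complex) ^ 4 = of_nat (Suc n) ^ 4" for n
      by (simp only: power_minus_even even_numeral)
    then show "(\<lambda>n. eisenstein_term (0, - 1 - int n)) sums (of_real pi ^ 4 / 90)"
      using zeta_4 by (simp only: eisenstein_term_def prod.case of_int_0 mult_zero_left add_0_left)
  qed
  then show ?thesis by simp
qed

lemma eisenstein_row_minus: "eisenstein_row (- m) = eisenstein_row m"
  unfolding eisenstein_row_def
proof (rule infsum_reindex_bij_witness[where i = uminus and j = uminus])
  fix n :: int
  have "(of_int m * rho + of_int (- n)) = - (of_int (- m) * rho + of_int n)" by simp
  then have "(of_int m * rho + of_int (- n)) ^ 4 = (of_int (- m) * rho + of_int n) ^ 4"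
    by (simp only: power_minus_even even_numeral)
  then show "eisenstein_term (m, - n) = eisenstein_term (- m, n)"
    by (simp only: eisenstein_term_def prod.case)
qed auto

lemma eisenstein_row_pos:
  "eisenstein_row (int (Suc m)) = 8 * of_real pi ^ 4 / 3 * (\<Sum>k. of_nat k ^ 3 * (q_rho ^ Suc m) ^ k)"
proof -
  define z where "z = of_nat (Suc m) * rho"
  have im: "Im z > 0" by (simp add: z_def Im_rho del: of_nat_Suc)
  then have zI: "z \<notin> \<int>" by (auto elim!: Ints_cases)
  have "eisenstein_row (int (Suc m)) = Polygamma 3 z / 6 + Polygamma 3 (1 - z) / 6"
    unfolding eisenstein_row_def
  proof (rule infsum_int_split[OF eisenstein_row_summable])
    show "(\<lambda>n. eisenstein_term (int (Suc m), int n)) sums (Polygamma 3 z / 6)"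
      using sums_inverse_power4_shifted[OF zI] by (simp add: eisenstein_term_def z_def)
    \<comment> \<open>Negation turns the negative half of the row into a one-sided sum based at 1 -
      z; the fourth power ignores the sign.\<close>
    have "z + of_int (- 1 - int n) = - (1 - z + of_nat n)" for n by simp
    then have "(z + of_int (- 1 - int n)) ^ 4 = (1 - z + of_nat n) ^ 4" for n
      by (simp only: power_minus_even even_numeral)
    then have "eisenstein_term (int (Suc m), - 1 - int n) = inverse ((1 - z + of_nat n) ^ 4)" for n
      by (simp only: eisenstein_term_def prod.case z_def of_int_of_nat_eq)
    then show "(\<lambda>n. eisenstein_term (int (Suc m), - 1 - int n)) sums (Polygamma 3 (1 - z) / 6)"
      using sums_inverse_power4_shifted[OF one_minus_not_Ints[OF zI]] by simp
  qed
  also have "\<dots> = 8 * of_real pi ^ 4 / 3 * (\<Sum>k. of_nat k ^ 3 * exp (2 * of_real pi * \<i> * z) ^ k)"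
    by (rule lipschitz_formula[OF im])
  also have "exp (2 * of_real pi * \<i> * z) = q_rho ^ Suc m"
    unfolding q_rho_def z_def exp_of_nat_mult [symmetric] by (simp only: mult_ac)
  finally show ?thesis .
qed

section \<open>Lambert series of the divisor sums\<close>

lemma summable_norm_divisor_sum_3:
  fixes q :: complex
  assumes q: "norm q < 1"
  shows "summable (\<lambda>n. norm (of_nat (divisor_sum 3 (Suc n)) * q ^ Suc n))"
proof -
  have "summable (\<lambda>n. real (Suc n) ^ 4 * norm q ^ Suc n)"
    using summable_norm_powers[OF q, of 4] by (subst summable_Suc_iff)
  then show ?thesis
    by (rule summable_comparison_test'[where N = 0])
       (use of_nat_divisor_sum_le[of 3] in \<open>auto simp: norm_mult norm_power simp del: of_nat_Suc power_Suc intro!: mult_right_mono\<close>)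
qed

text \<open>The absolutely convergent double series of k^3 q^(m k) over positive m and k is summed
  once by rows and once by the value of the product m k.\<close>

lemma lambert_cubes:
  fixes q :: complex
  assumes q: "norm q < 1"
  shows "(\<lambda>m. \<Sum>k. of_nat k ^ 3 * (q ^ Suc m) ^ k) sums (\<Sum>n. of_nat (divisor_sum 3 (Suc n)) * q ^ Suc n)"
proof -
  define S where "S = (SIGMA n:(UNIV :: nat set). {d. d dvd Suc n})"
  define g :: "nat \<times> nat \<Rightarrow> complex" where "g = (\<lambda>(n, d). of_nat d ^ 3 * q ^ Suc n)"
  define h :: "nat \<times> nat \<Rightarrow> complex" where "h = (\<lambda>(m, k). of_nat (Suc k) ^ 3 * (q ^ Suc m) ^ Suc k)"
  have fin: "finite {d. d dvd Suc n}" for n by simp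
  have S_cases: thesis if pS: "p \<in> S" and result: "\<And>n d e. p = (n, Suc d) \<Longrightarrow> Suc n = Suc d * Suc e \<Longrightarrow> thesis" for p thesis
  proof -
    obtain n d where p: "p = (n, d)" "d dvd Suc n" using pS by (auto simp: S_def)
    then obtain e where e: "Suc n = d * e" by (elim dvdE)
    then have "d \<noteq> 0" "e \<noteq> 0" by (metis mult_0 mult_0_right nat.distinct(1))+
    then obtain d' e' where "d = Suc d'" "e = Suc e'" using not0_implies_Suc by blast
    with p(1) e result show thesis by simp
  qed
  note sumabs = summable_norm_divisor_sum_3[OF q]
  have "(\<lambda>p. norm (g p)) summable_on S"
    unfolding S_def
  proof (subst Infinite_Sum.abs_summable_on_Sigma_iff, intro conjI ballI)
    have "(\<Sum>\<^sub>\<infinity>d\<in>{d. d dvd Suc n}. norm (g (n, d))) = norm (of_nat (divisor_sum 3 (Suc n)) * q ^ Suc n)" for n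
    proof -
      have "(\<Sum>\<^sub>\<infinity>d\<in>{d. d dvd Suc n}. norm (g (n, d))) = (\<Sum>d | d dvd Suc n. real d ^ 3 * norm q ^ Suc n)"
        using fin[of n] by (simp add: g_def norm_mult norm_power del: of_nat_Suc power_Suc)
      also have "\<dots> = real (divisor_sum 3 (Suc n)) * norm q ^ Suc n"
        by (simp add: divisor_sum_def sum_distrib_right del: of_nat_Suc power_Suc)
      also have "\<dots> = norm (of_nat (divisor_sum 3 (Suc n)) * q ^ Suc n)"
        by (simp only: norm_mult norm_of_nat norm_power)
      finally show ?thesis .
    qed
    then show "(\<lambda>n. norm (\<Sum>\<^sub>\<infinity>d\<in>{d. d dvd Suc n}. norm (g (n, d)))) summable_on UNIV"
      using norm_summable_imp_summable_on[of "\<lambda>n. norm (of_nat (divisor_sum 3 (Suc n)) * q ^ Suc n)"] sumabs by simp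
  qed (use fin in auto)
  then have gs: "g summable_on S" by (rule abs_summable_summable)
  have "infsum g S = (\<Sum>\<^sub>\<infinity>n. \<Sum>\<^sub>\<infinity>d\<in>{d. d dvd Suc n}. g (n, d))"
    using infsum_Sigma_banach[of g UNIV "\<lambda>n. {d. d dvd Suc n}"] gs by (simp add: S_def)
  also have "\<dots> = (\<Sum>\<^sub>\<infinity>n. of_nat (divisor_sum 3 (Suc n)) * q ^ Suc n)"
    using fin by (simp add: g_def divisor_sum_def sum_distrib_right del: of_nat_Suc power_Suc)
  also have "\<dots> = (\<Sum>n. of_nat (divisor_sum 3 (Suc n)) * q ^ Suc n)"
    using norm_summable_imp_has_sum[OF sumabs summable_sums[OF summable_norm_cancel[OF sumabs]]]
    by (rule infsumI)
  finally have gsum: "infsum g S = (\<Sum>n. of_nat (divisor_sum 3 (Suc n)) * q ^ Suc n)" .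
  have pred_prod: "Suc (Suc m * Suc k - 1) = Suc m * Suc k" for m k by simp
  \<comment> \<open>All indices are shifted by one: d = k + 1 divides n + 1 = (m + 1) (k +
    1).\<close>
  have "(g has_sum infsum g S) S = (h has_sum infsum g S) (UNIV \<times> UNIV)"
  proof (rule has_sum_reindex_bij_witness[where i = "\<lambda>(m, k). (Suc m * Suc k - 1, Suc k)" and j = "\<lambda>(n, d). (Suc n div d - 1, d - 1)"], goal_cases)
    case (1 p)
    then obtain n d e where p: "p = (n, Suc d)" "Suc n = Suc d * Suc e" by (rule S_cases)
    have "Suc n div Suc d = Suc e" unfolding p(2) by (rule nonzero_mult_div_cancel_left) simp
    with p show ?case by simp
  next
    case (3 p)
    obtain m k where p: "p = (m, k)" by (cases p)
    have "Suc (Suc m * Suc k - 1) div Suc k = Suc m"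
      unfolding pred_prod by (rule nonzero_mult_div_cancel_right) simp
    then show ?case by (simp only: p prod.case diff_Suc_1)
  next
    case (4 p)
    obtain m k where p: "p = (m, k)" by (cases p)
    show ?case unfolding p prod.case S_def by (intro SigmaI CollectI) (simp_all only: pred_prod UNIV_I dvd_triv_right)
  next
    case (5 p)
    then obtain n d e where p: "p = (n, Suc d)" "Suc n = Suc d * Suc e" by (rule S_cases)
    have "Suc n div Suc d = Suc e" unfolding p(2) by (rule nonzero_mult_div_cancel_left) simp
    moreover have "(q ^ Suc e) ^ Suc d = q ^ Suc n"
      unfolding p(2) by (simp only: power_mult [symmetric] mult.commute)
    ultimately show ?case by (simp add: p(1) h_def g_def del: power_Suc of_nat_Suc)
  qed (auto simp: S_def)
  then have hs: "(h has_sum infsum g S) (UNIV \<times> UNIV)" using gs by simp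
  have inner: "((\<lambda>k. h (m, k)) has_sum (\<Sum>k. of_nat k ^ 3 * (q ^ Suc m) ^ k)) UNIV" for m
  proof -
    have q': "norm (q ^ Suc m) < 1" using q by (simp add: norm_power power_less_one_iff del: power_Suc)
    have sm: "summable (\<lambda>k. norm (of_nat k ^ 3 * (q ^ Suc m) ^ k))"
      using summable_norm_powers[OF q', of 3] by (simp add: norm_mult norm_power)
    have "summable (\<lambda>k. norm (h (m, k)))"
      using summable_Suc_iff[of "\<lambda>k. norm (of_nat k ^ 3 * (q ^ Suc m) ^ k)"] sm by (simp add: h_def)
    moreover have "(\<lambda>k. h (m, k)) sums (\<Sum>k. of_nat k ^ 3 * (q ^ Suc m) ^ k)"
      \<comment> \<open>Dropping the term k = 0, which is zero, leaves the sum unchanged.\<close>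
      using summable_sums[OF summable_norm_cancel[OF sm]] unfolding h_def prod.case
      by (subst sums_Suc_iff) simp
    ultimately show ?thesis by (rule norm_summable_imp_has_sum)
  qed
  have "((\<lambda>m. \<Sum>k. of_nat k ^ 3 * (q ^ Suc m) ^ k) has_sum infsum g S) UNIV"
    using has_sum_SigmaD[OF hs inner] by simp
  then show ?thesis unfolding gsum by (rule has_sum_imp_sums)
qed

section \<open>The point \<open>q_rho\<close> and the values there\<close>

lemma q_rho_eq: "q_rho = - of_real (exp (- (pi * sqrt 3)))"
proof -
  have "2 * of_real pi * \<i> * rho = \<i> * of_real pi + of_real (- (pi * sqrt 3))"
    by (simp add: rho_def algebra_simps)
  then show ?thesis
    unfolding q_rho_def by (simp only: exp_add exp_of_real) (simp add: mult.commute)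
qed

lemma norm_q_rho_le: "norm q_rho \<le> 1 / 128"
proof -
  have "pi * sqrt 3 \<ge> 3 * (5 / 3)"
  proof (intro mult_mono)
    show "3 \<le> pi" using pi_gt3 by simp
    show "5 / 3 \<le> sqrt 3" by (rule real_le_rsqrt) (simp add: power2_eq_square)
  qed auto
  then have "5 \<le> pi * sqrt 3" by simp
  \<comment> \<open>A rational lower bound for exp 5 that still exceeds 128, from 1 + x <= exp x at
    x = 1/32.\<close>
  have "(33 / 32) ^ 160 \<le> exp (1 / 32 :: real) ^ 160"
    using exp_ge_add_one_self[of "1 / 32"] by (intro power_mono) auto
  also have "\<dots> = exp 5" by (simp flip: exp_of_nat_mult)
  also have "\<dots> \<le> exp (pi * sqrt 3)" using \<open>5 \<le> pi * sqrt 3\<close> by simp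
  finally have "128 \<le> exp (pi * sqrt 3)" by (simp add: power_divide)
  then have "inverse (exp (pi * sqrt 3)) \<le> inverse 128" by (rule le_imp_inverse_le) simp
  moreover have "norm q_rho = exp (- (pi * sqrt 3))"
    by (simp only: q_rho_eq norm_minus_cancel norm_of_real) simp
  ultimately show ?thesis by (simp add: exp_minus)
qed

text \<open>Rows m and - m agree, so the vanishing lattice sum is pi^4 / 45 + 2 * (8 pi^4 / 3) T =
  pi^4 / 45 * (1 + 240 T), and the last factor is the value of \<open>E4\<close>.\<close>

theorem E4_q_rho: "eval_fps E4 q_rho = 0"
proof -
  let ?T = "\<Sum>n. of_nat (divisor_sum 3 (Suc n)) * q_rho ^ Suc n"
  have q: "norm q_rho < 1" using norm_q_rho_le by simp
  have rows: "(\<lambda>m. eisenstein_row (int (Suc m))) sums (8 * of_real pi ^ 4 / 3 * ?T)"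
    unfolding eisenstein_row_pos by (intro sums_mult lambert_cubes q)
  have "infsum eisenstein_term (UNIV \<times> UNIV) = infsum eisenstein_row UNIV"
    unfolding eisenstein_row_def [abs_def]
    by (rule infsum_Sigma_banach [symmetric]) (simp add: eisenstein_term_summable)
  moreover have "infsum eisenstein_row UNIV = (8 * of_real pi ^ 4 / 3 * ?T + eisenstein_row (int 0)) + 8 * of_real pi ^ 4 / 3 * ?T"
  proof (rule infsum_int_split)
    show "eisenstein_row summable_on UNIV"
      unfolding eisenstein_row_def [abs_def]
      using summable_on_Sigma_banach[of "\<lambda>m n. eisenstein_term (m, n)" UNIV "\<lambda>_. UNIV"] eisenstein_term_summable
      by simp
    show "(\<lambda>n. eisenstein_row (int n)) sums (8 * of_real pi ^ 4 / 3 * ?T + eisenstein_row (int 0))"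
      by (rule sums_Suc) (rule rows)
    have "eisenstein_row (- 1 - int n) = eisenstein_row (int (Suc n))" for n
      using eisenstein_row_minus[of "int (Suc n)"] by simp
    then show "(\<lambda>n. eisenstein_row (- 1 - int n)) sums (8 * of_real pi ^ 4 / 3 * ?T)"
      using rows by simp
  qed
  ultimately have "of_real pi ^ 4 / 45 * (1 + 240 * ?T) = 0"
    using eisenstein_sum_zero by (simp add: eisenstein_row_0 algebra_simps)
  then have zero: "1 + 240 * ?T = 0" by simp
  have "summable (\<lambda>n. fps_nth E4 n * q_rho ^ n)"
    by (rule summable_fps, rule less_le_trans[OF _ fps_conv_radius_E4]) (use q in simp)
  then have "eval_fps E4 q_rho = 1 + (\<Sum>n. fps_nth E4 (Suc n) * q_rho ^ Suc n)"
    using suminf_split_head by (fastforce simp: eval_fps_def)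
  also have "(\<Sum>n. fps_nth E4 (Suc n) * q_rho ^ Suc n) = (\<Sum>n. 240 * (of_nat (divisor_sum 3 (Suc n)) * q_rho ^ Suc n))"
    by (simp add: E4_def mult.assoc)
  also have "\<dots> = 240 * ?T"
    by (rule suminf_mult, rule summable_norm_cancel, rule summable_norm_divisor_sum_3[OF q])
  finally show ?thesis using zero by simp
qed

lemma fps_conv_radius_E2: "fps_conv_radius E2 \<ge> 1"
  by (rule fps_conv_radius_ge_1[of _ 24 2])
     (use of_nat_divisor_sum_le[of 1, unfolded one_add_one] in \<open>auto simp: E2_def norm_mult\<close>)

text \<open>Ramanujan's identity evaluated at \<open>q_rho\<close>, where the product
  \<open>E2 * E4\<close> drops out.\<close>

theorem Theta_E4_q_rho: "eval_fps (Theta E4) q_rho = - eval_fps E6 q_rho / 3"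
proof -
  have r: "ereal (norm q_rho) < fps_conv_radius f" if "fps_conv_radius f \<ge> 1" for f :: "complex fps"
    by (rule less_le_trans[OF _ that]) (use norm_q_rho_le in simp)
  note radii = r[OF fps_conv_radius_E2] r[OF fps_conv_radius_E4] r[OF fps_conv_radius_E6]
    less_le_trans[OF r[OF fps_conv_radius_E4] fps_conv_radius_Theta]
  have "3 * eval_fps (Theta E4) q_rho = eval_fps (3 * Theta E4) q_rho"
    using radii by (simp add: eval_fps_mult)
  also have "\<dots> = eval_fps (E2 * E4) q_rho - eval_fps E6 q_rho"
    unfolding ramanujan_Theta_E4
    by (rule eval_fps_diff; use radii in \<open>auto intro: less_le_trans[OF _ fps_conv_radius_mult]\<close>)
  also have "\<dots> = - eval_fps E6 q_rho"
    using radii by (simp add: eval_fps_mult E4_q_rho)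
  finally show ?thesis by (simp add: field_simps)
qed

theorem theorem3:
  shows "(\<forall>n::nat. n \<ge> 1 \<longrightarrow> (\<exists>m::nat. m \<ge> 1 \<and> (-1) ^ n * beta4 n = 240 * of_nat m)) \<and>
    beta4 \<sim>[sequentially]
      (\<lambda>n. - (1 / eval_fps (Theta E4) q_rho) * q_rho powi (- int n)) \<and>
    eval_fps (Theta E4) q_rho = - eval_fps E6 q_rho / 3"
proof -
  interpret E4_zero q_rho
    by standard (use E4_q_rho norm_q_rho_le in \<open>auto simp: q_rho_eq\<close>)
  show ?thesis
    using beta4_sign_and_divisibility beta4_asymp Theta_E4_q_rho by auto
qed

end
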